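(* Let $\lambda,\mu,\xi>0$, $\alpha\in(0,1]$, $\theta=\lambda+\mu+\xi$, $p_1=\lambda/\theta$, $p_2=\mu/\theta$, $p_3=\xi/\theta$. Let $\hat p_1=n_a/n$, $\hat p_2=n_s/n$, $\hat p_3=n_c/n$ be the observed proportions of arrivals, service completions and catastrophes among $n$ observed events, let $\hat\theta$ be the moment estimator of $\theta$ based on the $n$ corresponding waiting times (sampling scheme and $\hat\theta$ as defined in the context), and let $\hat\lambda=\hat p_1\hat\theta$, $\hat\mu=\hat p_2\hat\theta$, $\hat\xi=\hat p_3\hat\theta$. Then, as $n\to\infty$, in distribution, $$\sqrt n(\hat\lambda-\lambda)\to N\left(0,\theta^2p_1(1-p_1)+p_1^2\sigma_\theta^2\right),$$ $$\sqrt n(\hat\mu-\mu)\to N\left(0,\theta^2p_2(1-p_2)+p_2^2\sigma_\theta^2\right),$$ $$\sqrt n(\hat\xi-\xi)\to N\left(0,\theta^2p_3(1-p_3)+p_3^2\sigma_\theta^2\right),$$ where $$\sigma_\theta^2=\frac{\theta^2\left[20\pi^4(2-\alpha^2)-3\pi^2(\alpha^4+20\alpha^2-32)(\ln\theta)^2-720\,\alpha^3(\ln\theta)\,\zeta(3)\right]}{120\pi^2}$$ and $\zeta(3)$ is the Riemann zeta function evaluated at $3$.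
   Context: Setting: the fractional $M/M/1$ queue with catastrophes with arrival rate $\lambda$, service rate $\mu$, catastrophe rate $\xi$ and fractional parameter $\alpha$, observed at $n$ events occurring while the queue is non-empty. Sampling scheme. The waiting times $S^\alpha_1,\dots,S^\alpha_n$ preceding these events are i.i.d. with the Mittag-Leffler law of density $$f_{S^\alpha}(t)=\theta t^{\alpha-1}E_{\alpha,\alpha}(-\theta t^\alpha),\quad t>0,\qquad E_{\alpha,\gamma}(w)=\sum_{r=0}^\infty\frac{w^r}{\Gamma(\alpha r+\gamma)}.$$ The types of the $n$ events are i.i.d., independent of the waiting times, each being an arrival, a service completion or a catastrophe with probabilities $p_1,p_2,p_3$ respectively (a Multinomial$(1,p_1,p_2,p_3)$ trial). $n_a,n_s,n_c$ are the numbers of arrivals, service completions and catastrophes, so $n=n_a+n_s+n_c$. Moment estimators. With $$\hat m=\frac1n\sum_{j=1}^n\ln S^\alpha_j,\qquad \hat v=\frac1n\sum_{j=1}^n(\ln S^\alpha_j-\hat m)^2,$$ put $$\hat\alpha=\frac{\pi}{\sqrt{3(\hat v+\pi^2/6)}},\qquad \hat\theta=\exp\left(-\hat\alpha(\hat m+\gamma)\right),$$ where $\gamma=0.57721\ldots$ is the Euler–Mascheroni constant. $N(0,\sigma^2)$ is the normal law with mean $0$ and variance $\sigma^2$. *)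

theory Defs
  imports "HOL-Probability.Probability"
begin

definition mittag_leffler :: "real \<Rightarrow> real \<Rightarrow> real \<Rightarrow> real" where
  "mittag_leffler a g w = (\<Sum>r. w ^ r / Gamma (a * real r + g))"

definition ml_waiting_density :: "real \<Rightarrow> real \<Rightarrow> real \<Rightarrow> real" where
  "ml_waiting_density \<alpha> \<theta> t =
     (if t > 0 then \<theta> * t powr (\<alpha> - 1) * mittag_leffler \<alpha> \<alpha> (- \<theta> * t powr \<alpha>) else 0)"

datatype queue_event = Arrival | Service | Catastrophe

text \<open>
  A sample is a pair of sequences S (waiting times) and K (event types) of random variables on a
  sample space; the n observations are those with index 0, ..., n - 1.
\<close>

definition log_mean :: "(nat \<Rightarrow> 'a \<Rightarrow> real) \<Rightarrow> nat \<Rightarrow> 'a \<Rightarrow> real" where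
  "log_mean S n \<omega> = (\<Sum>j<n. ln (S j \<omega>)) / real n"

definition log_variance :: "(nat \<Rightarrow> 'a \<Rightarrow> real) \<Rightarrow> nat \<Rightarrow> 'a \<Rightarrow> real" where
  "log_variance S n \<omega> = (\<Sum>j<n. (ln (S j \<omega>) - log_mean S n \<omega>)\<^sup>2) / real n"

definition alpha_hat :: "(nat \<Rightarrow> 'a \<Rightarrow> real) \<Rightarrow> nat \<Rightarrow> 'a \<Rightarrow> real" where
  "alpha_hat S n \<omega> = pi / sqrt (3 * (log_variance S n \<omega> + pi\<^sup>2 / 6))"

definition theta_hat :: "(nat \<Rightarrow> 'a \<Rightarrow> real) \<Rightarrow> nat \<Rightarrow> 'a \<Rightarrow> real" where
  "theta_hat S n \<omega> = exp (- alpha_hat S n \<omega> * (log_mean S n \<omega> + euler_mascheroni))"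

definition event_count :: "(nat \<Rightarrow> 'a \<Rightarrow> queue_event) \<Rightarrow> queue_event \<Rightarrow> nat \<Rightarrow> 'a \<Rightarrow> nat" where
  "event_count K e n \<omega> = card {j. j < n \<and> K j \<omega> = e}"

definition p_hat :: "(nat \<Rightarrow> 'a \<Rightarrow> queue_event) \<Rightarrow> queue_event \<Rightarrow> nat \<Rightarrow> 'a \<Rightarrow> real" where
  "p_hat K e n \<omega> = real (event_count K e n \<omega>) / real n"

definition rate_hat ::
    "(nat \<Rightarrow> 'a \<Rightarrow> real) \<Rightarrow> (nat \<Rightarrow> 'a \<Rightarrow> queue_event) \<Rightarrow> queue_event \<Rightarrow> nat \<Rightarrow> 'a \<Rightarrow> real" where
  "rate_hat S K e n \<omega> = p_hat K e n \<omega> * theta_hat S n \<omega>"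

text \<open>The Dirichlet series of the Riemann zeta function, meaningful for real s > 1 only.\<close>

definition zeta :: "real \<Rightarrow> real" where
  "zeta s = (\<Sum>k. 1 / real (Suc k) powr s)"

definition sigma_theta_sq :: "real \<Rightarrow> real \<Rightarrow> real" where
  "sigma_theta_sq \<alpha> \<theta> =
     \<theta>\<^sup>2 * (20 * pi ^ 4 * (2 - \<alpha>\<^sup>2)
           - 3 * pi\<^sup>2 * (\<alpha> ^ 4 + 20 * \<alpha>\<^sup>2 - 32) * (ln \<theta>)\<^sup>2
           - 720 * \<alpha> ^ 3 * ln \<theta> * zeta 3) / (120 * pi\<^sup>2)"

text \<open>
  Independence of two random elements; unlike indep_var, it allows them to have different types.
\<close>

definition indep_rv_pair ::
    "'a measure \<Rightarrow> 'b measure \<Rightarrow> ('a \<Rightarrow> 'b) \<Rightarrow> 'c measure \<Rightarrow> ('a \<Rightarrow> 'c) \<Rightarrow> bool" where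
  "indep_rv_pair M N X N' Y \<longleftrightarrow>
     X \<in> measurable M N \<and> Y \<in> measurable M N' \<and>
     prob_space.indep_set M {X -` A \<inter> space M |A. A \<in> sets N} {Y -` B \<inter> space M |B. B \<in> sets N'}"

text \<open>
  The second parameter v is the variance, whereas normal_density takes the standard deviation.
  This is the normal law for v > 0 only; the degenerate law v = 0 is not covered.
\<close>

definition normal_law :: "real \<Rightarrow> real \<Rightarrow> real measure" where
  "normal_law m v = density lborel (\<lambda>x. ennreal (normal_density m (sqrt v) x))"

end

theory Submission
  imports Defs "HOL-Complex_Analysis.Complex_Analysis"
begin

text \<open>
  Write \<open>L(u) = \<theta> / (\<theta> + u\<^sup>\<alpha>)\<close>. For large \<open>u\<close>, integrating the Mittag-Leffler series term by term shows that
  \<open>\<integral> exp(-u t) f(t) dt = L(u)\<close>, where \<open>f\<close> is the waiting time density. By hypothesis the law of a waiting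
  time \<open>S\<close> has density \<open>ennreal (f t)\<close>, that is, the positive part of \<open>f\<close>; so the
  first thing to prove is that \<open>f\<close> is nonnegative almost everywhere. All iterated differences
  \<open>g(x) - g(x + 1)\<close> of \<open>L\<close> are nonnegative (\<open>fdiff_pow_laplace_nonneg\<close>), because the differences of
  powers \<open>x powr -c\<close> are and the class of such functions is closed under products. Hence
  \<open>exp(-u t) f(t)\<close> integrates every polynomial \<open>x\<^sup>j (1 - x)\<^sup>k\<close> in \<open>x = exp(-t)\<close>, and so, by Bernstein
  approximation, every nonnegative continuous function of \<open>exp(-t)\<close>, to something nonnegative. This is
  Hausdorff's moment argument; it gives \<open>AE_ml_waiting_density_nonneg\<close>.

  Now \<open>E exp(-u S) = L(u)\<close> for large \<open>u\<close>, and by analytic continuation for all \<open>u > 0\<close>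
  (\<open>ml_waiting_time_laplace\<close>). Integrating \<open>E(S exp(-u S)) = -L'(u)\<close> against \<open>u powr -r\<close>, with
  Tonelli's theorem on both sides, yields for \<open>\<bar>r\<bar> < \<alpha>\<close>
  \<open>E (S powr r) = \<theta> powr (-r/\<alpha>) \<Gamma>(1 + r/\<alpha>) \<Gamma>(1 - r/\<alpha>) / \<Gamma>(1 - r)\<close>. This is the moment generating function
  of \<open>ln S\<close>. For \<open>Y = ln S + ln \<theta> / \<alpha> + \<gamma>\<close> its logarithmic derivative is a combination of polygamma
  functions, and so (\<open>log_moments_of_laplace\<close>) \<open>E Y = 0\<close>, \<open>E Y\<^sup>2 = \<pi>\<^sup>2 / (3 \<alpha>\<^sup>2) - \<pi>\<^sup>2 / 6\<close>,
  \<open>E Y\<^sup>3 = -2 \<zeta>(3)\<close>, and the fourth cumulant of \<open>Y\<close> is \<open>\<pi>\<^sup>4 (2 / \<alpha>\<^sup>4 - 1) / 15\<close>.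

  For \<open>n > 0\<close> the estimator of a rate is a fixed function, differentiable at the expectations, of the sample
  means of three centred i.i.d. sequences: the indicator of the event type minus its probability \<open>p\<close>, \<open>Y\<close>, and
  \<open>Y\<^sup>2 - E Y\<^sup>2\<close>. By Chebyshev the error of its linearisation is negligible at scale \<open>1 / sqrt n\<close>
  (\<open>delta_method_remainder\<close>), the linear part is itself a sample mean of an i.i.d. sequence \<open>Z\<close>, and
  the central limit theorem together with Slutsky's argument (\<open>weak_conv_m_add_vanishing\<close>) gives
  normal convergence. The variance of \<open>Z\<close> splits because event types and waiting times are independent,
  and the moments of \<open>Y\<close> turn its second part into \<open>p\<^sup>2 sigma_theta_sq \<alpha> \<theta>\<close>
  (\<open>sigma_theta_sq_eq_moments\<close>).
\<close>

section \<open>Iterated differences and complete monotonicity\<close>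

text \<open>
  The forward difference with unit step, negated. The sign is such that the discrete analogue of a completely
  monotone function is one all of whose iterates \<open>(fdiff ^^ k) g\<close> are nonnegative.
\<close>
definition fdiff :: "(real \<Rightarrow> real) \<Rightarrow> real \<Rightarrow> real" where
  "fdiff g x = g x - g (x + 1)"

lemma fdiff_pow_shift: "(fdiff ^^ k) (\<lambda>x. g (x + 1)) x = (fdiff ^^ k) g (x + 1)"
  by (induction k arbitrary: x) (simp_all add: fdiff_def)

lemma fdiff_pow_add: "(fdiff ^^ k) (\<lambda>x. g x + h x) x = (fdiff ^^ k) g x + (fdiff ^^ k) h x"
  by (induction k arbitrary: x) (simp_all add: fdiff_def)

lemma fdiff_pow_cmult: "(fdiff ^^ k) (\<lambda>x. c * g x) x = c * (fdiff ^^ k) g x"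
  by (induction k arbitrary: x) (simp_all add: fdiff_def algebra_simps)

lemma fdiff_pow_cong:
  assumes "\<And>y. y > 0 \<Longrightarrow> g y = h y" "x > 0"
  shows "(fdiff ^^ k) g x = (fdiff ^^ k) h x"
  using assms(2) by (induction k arbitrary: x) (simp_all add: fdiff_def assms(1))

text \<open>
  Closure under products, by the Leibniz rule for \<open>fdiff\<close>. The bound \<open>m\<close> on the order is kept so that
  the lemma can be used inside an induction on the order.
\<close>
lemma fdiff_pow_mult_nonneg:
  assumes "\<And>k x. k \<le> m \<Longrightarrow> x > 0 \<Longrightarrow> (fdiff ^^ k) g x \<ge> 0"
    and "\<And>k x. k \<le> m \<Longrightarrow> x > 0 \<Longrightarrow> (fdiff ^^ k) h x \<ge> 0"
    and "x > 0"
  shows "(fdiff ^^ m) (\<lambda>x. g x * h x) x \<ge> 0"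
  using assms
proof (induction m arbitrary: g h x)
  case 0
  then show ?case by (metis funpow_0 le_refl mult_nonneg_nonneg)
next
  case (Suc m)
  have leibniz: "fdiff (\<lambda>x. g x * h x) = (\<lambda>x. g x * fdiff h x + fdiff g x * h (x + 1))"
    by (auto simp: fdiff_def algebra_simps)
  have diff_nonneg: "(fdiff ^^ k) (fdiff f) y \<ge> 0"
    if "\<And>k x. k \<le> Suc m \<Longrightarrow> x > 0 \<Longrightarrow> (fdiff ^^ k) f x \<ge> 0" "k \<le> m" "y > 0" for k f y
    using that(1)[of "Suc k" y] that(2,3) by (simp add: funpow_swap1)
  have "(fdiff ^^ m) (\<lambda>x. g x * fdiff h x) x \<ge> 0"
    by (rule Suc.IH) (use Suc.prems in \<open>auto intro!: diff_nonneg\<close>)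
  moreover have "(fdiff ^^ m) (\<lambda>x. fdiff g x * h (x + 1)) x \<ge> 0"
    by (rule Suc.IH) (use Suc.prems in \<open>auto intro!: diff_nonneg simp: fdiff_pow_shift\<close>)
  ultimately show ?case
    by (simp add: funpow_Suc_right leibniz fdiff_pow_add del: funpow.simps)
qed

lemma has_real_derivative_fdiff_pow:
  assumes "\<And>y. y > 0 \<Longrightarrow> (g has_real_derivative g' y) (at y)" "x > 0"
  shows "((fdiff ^^ k) g has_real_derivative (fdiff ^^ k) g' x) (at x)"
  using assms(2)
proof (induction k arbitrary: x)
  case (Suc k)
  have 1: "((fdiff ^^ k) g has_real_derivative (fdiff ^^ k) g' x) (at x)"
    using Suc by simp
  have "((fdiff ^^ k) g has_real_derivative (fdiff ^^ k) g' (x + 1)) (at (x + 1))"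
    using Suc by simp
  hence 2: "((\<lambda>x. (fdiff ^^ k) g (x + 1)) has_real_derivative (fdiff ^^ k) g' (x + 1)) (at x)"
    by (simp add: DERIV_shift)
  have Suc_eq: "(fdiff ^^ Suc k) f = (\<lambda>x. (fdiff ^^ k) f x - (fdiff ^^ k) f (x + 1))" for f
    by (auto simp: fdiff_def[of "(fdiff ^^ k) f"])
  show ?case unfolding Suc_eq by (rule DERIV_diff[OF 1 2])
qed (simp add: assms(1))

text \<open>
  Going up one order costs one derivative, and differentiating \<open>x powr -c\<close> only changes the exponent;
  so the induction has to run over all exponents at once.
\<close>
lemma fdiff_pow_powr_nonneg:
  assumes "c \<ge> 0" "x > 0"
  shows "(fdiff ^^ k) (\<lambda>x. x powr (- c)) x \<ge> 0"
  using assms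
proof (induction k arbitrary: c x)
  case (Suc k)
  let ?F = "(fdiff ^^ k) (\<lambda>x. x powr (- c))"
  have "?F (x + 1) \<le> ?F x"
  proof (rule DERIV_nonpos_imp_nonincreasing[of x "x + 1"])
    fix y assume "x \<le> y" "y \<le> x + 1"
    hence y: "y > 0" using Suc.prems by simp
    have "(?F has_real_derivative (fdiff ^^ k) (\<lambda>y. (-c) * y powr (- (c + 1))) y) (at y)"
      by (rule has_real_derivative_fdiff_pow)
         (use y in \<open>auto intro!: derivative_eq_intros simp: powr_minus powr_add powr_diff field_simps\<close>)
    moreover have "(fdiff ^^ k) (\<lambda>y. (-c) * y powr (- (c + 1))) y \<le> 0"
      unfolding fdiff_pow_cmult using Suc.IH[of "c + 1" y] Suc.prems y by simp
    ultimately show "\<exists>z. (?F has_real_derivative z) (at y) \<and> z \<le> 0" by blast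
  qed auto
  thus ?case by (simp add: fdiff_def[of ?F])
qed simp

lemma fdiff_pow_powr_increment_nonneg:
  assumes "0 < \<alpha>" "\<alpha> \<le> 1" "x > 0"
  shows "(fdiff ^^ k) (\<lambda>x. (x + 1) powr \<alpha> - x powr \<alpha>) x \<ge> 0"
proof -
  let ?F = "(fdiff ^^ k) (\<lambda>x. x powr \<alpha>)"
  have "?F x \<le> ?F (x + 1)"
  proof (rule DERIV_nonneg_imp_nondecreasing[of x "x + 1"])
    fix y assume "x \<le> y" "y \<le> x + 1"
    hence y: "y > 0" using assms by simp
    have "(?F has_real_derivative (fdiff ^^ k) (\<lambda>y. \<alpha> * y powr (- (1 - \<alpha>))) y) (at y)"
      by (rule has_real_derivative_fdiff_pow)
         (use y in \<open>auto intro!: derivative_eq_intros simp: powr_diff\<close>)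
    moreover have "(fdiff ^^ k) (\<lambda>y. \<alpha> * y powr (- (1 - \<alpha>))) y \<ge> 0"
      unfolding fdiff_pow_cmult using fdiff_pow_powr_nonneg[of "1 - \<alpha>" y k] assms y by simp
    ultimately show "\<exists>z. (?F has_real_derivative z) (at y) \<and> z \<ge> 0" by blast
  qed auto
  moreover have "(fdiff ^^ k) (\<lambda>x. (x + 1) powr \<alpha> - x powr \<alpha>) x = ?F (x + 1) - ?F x"
    using fdiff_pow_add[of k "\<lambda>x. (x + 1) powr \<alpha>" "\<lambda>x. (-1) * x powr \<alpha>" x]
      fdiff_pow_shift[of k "\<lambda>x. x powr \<alpha>" x]
    unfolding fdiff_pow_cmult by simp
  ultimately show ?thesis by simp
qed

text \<open>
  With \<open>L x = \<theta> / (\<theta> + x powr \<alpha>)\<close> one has \<open>L x - L (x + 1) = L x * L (x + 1) * w x\<close>, where \<open>w\<close> is the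
  increment of \<open>x powr \<alpha>\<close> divided by \<open>\<theta>\<close>. The induction on the order therefore reduces to products.
\<close>
lemma fdiff_pow_laplace_nonneg:
  assumes "0 < \<alpha>" "\<alpha> \<le> 1" "\<theta> > 0" "x > 0"
  shows "(fdiff ^^ k) (\<lambda>x. \<theta> / (\<theta> + x powr \<alpha>)) x \<ge> 0"
  using assms(4)
proof (induction k arbitrary: x rule: less_induct)
  case (less k)
  let ?L = "\<lambda>x. \<theta> / (\<theta> + x powr \<alpha>)"
  show ?case
  proof (cases k)
    case 0
    then show ?thesis using assms by simp
  next
    case (Suc m)
    define w where "w x = (1 / \<theta>) * ((x + 1) powr \<alpha> - x powr \<alpha>)" for x
    have L: "fdiff ?L y = ?L y * (?L (y + 1) * w y)" if "y > 0" for y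
    proof -
      have pos: "\<theta> + y powr \<alpha> > 0" "\<theta> + (y + 1) powr \<alpha> > 0"
        using assms by (auto intro!: add_pos_nonneg)
      show ?thesis using pos assms(3) unfolding fdiff_def w_def
        by (simp add: divide_simps) (simp add: algebra_simps)
    qed
    have w: "(fdiff ^^ j) w y \<ge> 0" if "y > 0" for j y
      using fdiff_pow_powr_increment_nonneg[OF assms(1,2) that, of j] assms(3)
      unfolding w_def fdiff_pow_cmult by simp
    have IH: "(fdiff ^^ j) ?L y \<ge> 0" if "j \<le> m" "y > 0" for j y
      using less.IH[of j y] Suc that by simp
    have IH2: "(fdiff ^^ j) (\<lambda>y. ?L (y + 1)) y \<ge> 0" if "j \<le> m" "y > 0" for j y
      using fdiff_pow_shift[of j ?L y] IH[of j "y + 1"] that by simp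
    have "(fdiff ^^ j) (\<lambda>y. ?L (y + 1) * w y) y \<ge> 0" if "j \<le> m" "y > 0" for j y
      by (rule fdiff_pow_mult_nonneg[OF _ w]) (use IH2 that in \<open>auto simp del: times_divide_eq_left times_divide_eq_right\<close>)
    note step = this
    have "(fdiff ^^ m) (\<lambda>y. ?L y * (?L (y + 1) * w y)) x \<ge> 0"
      by (rule fdiff_pow_mult_nonneg[OF IH step less.prems])
    also have "(fdiff ^^ m) (\<lambda>y. ?L y * (?L (y + 1) * w y)) x = (fdiff ^^ m) (fdiff ?L) x"
      by (rule fdiff_pow_cong) (use less.prems L in auto)
    finally show ?thesis unfolding Suc by (simp add: funpow_swap1)
  qed
qed

section \<open>Nonnegativity of the Mittag-Leffler density\<close>
lemma nn_integral_powr_exp: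
  fixes p u :: real
  assumes "p > 0" "u > 0"
  shows "(\<integral>\<^sup>+t. ennreal (indicator {0<..} t * (t powr (p - 1) * exp (- (u * t)))) \<partial>lborel)
           = ennreal (Gamma p / u powr p)"
proof -
  have "ennreal (Gamma p) = (\<integral>\<^sup>+t. ennreal (indicator {0..} t * t powr (p - 1) / exp t) \<partial>lborel)"
    using Gamma_conv_nn_integral_real[OF assms(1)] .
  also have "\<dots> = (\<integral>\<^sup>+t. ennreal (indicator {0..} (u * t) * (u * t) powr (p - 1) / exp (u * t)) * u \<partial>lborel)"
    using assms by (subst nn_integral_real_affine[where c = u and t = 0]) (auto simp: nn_integral_cmult mult.commute)
  also have "\<dots> = (\<integral>\<^sup>+t. ennreal (u powr p) * ennreal (indicator {0<..} t * (t powr (p - 1) * exp (- (u * t)))) \<partial>lborel)"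
  proof (rule nn_integral_cong_AE, rule AE_mp[OF AE_lborel_singleton[of 0]], rule AE_I2, rule impI)
    fix t :: real assume "t \<noteq> 0"
    thus "ennreal (indicator {0..} (u * t) * (u * t) powr (p - 1) / exp (u * t)) * u =
      ennreal (u powr p) * ennreal (indicator {0<..} t * (t powr (p - 1) * exp (- (u * t))))"
      using assms
      by (auto simp: indicator_def zero_le_mult_iff powr_mult powr_diff exp_minus field_simps
               simp flip: ennreal_mult)
  qed
  also have "\<dots> = ennreal (u powr p) * (\<integral>\<^sup>+t. ennreal (indicator {0<..} t * (t powr (p - 1) * exp (- (u * t)))) \<partial>lborel)"
    by (rule nn_integral_cmult) auto
  finally have eq: "ennreal (Gamma p) = ennreal (u powr p) * (\<integral>\<^sup>+t. ennreal (indicator {0<..} t * (t powr (p - 1) * exp (- (u * t)))) \<partial>lborel)" (is "_ = _ * ?I") .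
  have "ennreal (Gamma p / u powr p) = ennreal (1 / u powr p) * ennreal (Gamma p)"
    using assms by (simp flip: ennreal_mult)
  also have "\<dots> = ennreal (1 / u powr p) * ennreal (u powr p) * ?I"
    unfolding eq by (simp add: mult.assoc)
  also have "ennreal (1 / u powr p) * ennreal (u powr p) = 1"
    using assms by (simp flip: ennreal_mult)
  finally show ?thesis by simp
qed

lemma has_bochner_integral_powr_exp:
  fixes p u :: real
  assumes "p > 0" "u > 0"
  shows "has_bochner_integral lborel (\<lambda>t. indicator {0<..} t * (t powr (p - 1) * exp (- (u * t))))
           (Gamma p / u powr p)"
  by (rule has_bochner_integral_nn_integral)
     (use nn_integral_powr_exp[OF assms] assms in \<open>auto intro!: AE_I2 divide_nonneg_nonneg Gamma_real_nonneg\<close>)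

text \<open>
  Term by term the series becomes a geometric series in \<open>\<theta> / u powr \<alpha>\<close>, so the interchange of sum and
  integral is justified only for \<open>u powr \<alpha> > \<theta>\<close>. The same geometric majorant shows that the
  Mittag-Leffler series converges absolutely for almost every \<open>t\<close>, which is all that is needed.
\<close>
lemma has_bochner_integral_ml_waiting_density_exp:
  assumes "0 < \<alpha>" "\<theta> > 0" "u > 0" "u powr \<alpha> > \<theta>"
  shows "has_bochner_integral lborel (\<lambda>t. ml_waiting_density \<alpha> \<theta> t * exp (- (u * t)))
           (\<theta> / (\<theta> + u powr \<alpha>))"
proof -
  define c where "c r = (- \<theta>) ^ r * \<theta> / Gamma (\<alpha> * real r + \<alpha>)" for r :: nat
  define G where "G r t = indicator {0<..} t * (t powr (\<alpha> * real r + \<alpha> - 1) * exp (- (u * t)))"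
    for r :: nat and t :: real
  define q where "q = \<theta> / u powr \<alpha>"
  have q: "0 < q" "q < 1" using assms by (auto simp: q_def)
  have pos: "\<alpha> * real r + \<alpha> > 0" for r using assms by (intro add_nonneg_pos) auto
  have Gpos: "Gamma (\<alpha> * real r + \<alpha>) > 0" for r by (rule Gamma_real_pos[OF pos])
  have G: "has_bochner_integral lborel (G r) (Gamma (\<alpha> * real r + \<alpha>) / u powr (\<alpha> * real r + \<alpha>))" for r
    unfolding G_def by (rule has_bochner_integral_powr_exp[OF pos assms(3)])
  have Gnn: "G r t \<ge> 0" for r t by (simp add: G_def)
  have upow: "u powr (\<alpha> * real r + \<alpha>) = (u powr \<alpha>) ^ Suc r" for r
    using assms by (simp add: powr_add powr_powr[symmetric] powr_realpow)
  have int: "has_bochner_integral lborel (\<lambda>t. c r * G r t) (q * (- q) ^ r)" for r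
  proof -
    have "c r * (Gamma (\<alpha> * real r + \<alpha>) / u powr (\<alpha> * real r + \<alpha>)) = q * (- q) ^ r"
      unfolding c_def upow q_def using Gpos[of r] assms(3)
      by (simp add: power_divide minus_divide_left del: minus_divide_left[symmetric])
    thus ?thesis using has_bochner_integral_mult_right[OF G[of r], of "c r"] by simp
  qed
  have intn: "has_bochner_integral lborel (\<lambda>t. norm (c r * G r t)) (q * q ^ r)" for r
  proof -
    have "\<bar>c r\<bar> * (Gamma (\<alpha> * real r + \<alpha>) / u powr (\<alpha> * real r + \<alpha>)) = q * q ^ r"
      unfolding c_def upow q_def using Gpos[of r] assms
      by (simp add: field_simps power_divide abs_mult power_abs)
    thus ?thesis using has_bochner_integral_mult_right[OF G[of r], of "\<bar>c r\<bar>"] Gnn by (simp add: abs_mult)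
  qed
  have sumq: "summable (\<lambda>r. q * q ^ r)" using q by (intro summable_mult summable_geometric) auto
  have AEs: "AE t in lborel. summable (\<lambda>r. norm (c r * G r t))"
  proof -
    have "(\<integral>\<^sup>+t. (\<Sum>r. ennreal (norm (c r * G r t))) \<partial>lborel) = (\<Sum>r. \<integral>\<^sup>+t. ennreal (norm (c r * G r t)) \<partial>lborel)"
      by (rule nn_integral_suminf) (auto simp: G_def)
    also have "\<dots> = (\<Sum>r. ennreal (q * q ^ r))"
      using intn by (subst nn_integral_eq_integral) (auto simp: has_bochner_integral_iff)
    also have "\<dots> \<noteq> \<infinity>"
      using sumq q by (subst suminf_ennreal2) auto
    finally have "AE t in lborel. (\<Sum>r. ennreal (norm (c r * G r t))) \<noteq> \<infinity>"
      by (intro nn_integral_noteq_infinite) (auto simp: G_def)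
    thus ?thesis
      by eventually_elim (rule summable_suminf_not_top, auto)
  qed
  have 1: "integrable lborel (\<lambda>t. \<Sum>r. c r * G r t)"
    by (rule integrable_suminf[OF _ AEs]) (use int intn sumq in \<open>auto simp: has_bochner_integral_iff\<close>)
  have "integral\<^sup>L lborel (\<lambda>t. \<Sum>r. c r * G r t) = (\<Sum>r. q * (- q) ^ r)"
    by (subst integral_suminf[OF _ AEs]) (use int intn sumq in \<open>auto simp: has_bochner_integral_iff\<close>)
  also have "\<dots> = q * (1 / (1 + q))"
    using q by (subst suminf_mult) (auto intro!: summable_geometric simp: suminf_geometric)
  also have "\<dots> = \<theta> / (\<theta> + u powr \<alpha>)" using assms by (simp add: q_def field_simps)
  finally have 2: "integral\<^sup>L lborel (\<lambda>t. \<Sum>r. c r * G r t) = \<theta> / (\<theta> + u powr \<alpha>)" .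
  have AEeq: "AE t in lborel. (\<Sum>r. c r * G r t) = ml_waiting_density \<alpha> \<theta> t * exp (- (u * t))"
    using AEs
  proof eventually_elim
    fix t assume s: "summable (\<lambda>r. norm (c r * G r t))"
    show "(\<Sum>r. c r * G r t) = ml_waiting_density \<alpha> \<theta> t * exp (- (u * t))"
    proof (cases "t > 0")
      case True
      define d where "d = \<theta> * t powr (\<alpha> - 1) * exp (- (u * t))"
      have d: "d \<noteq> 0" using True assms by (simp add: d_def)
      have eq: "c r * G r t = d * ((- \<theta> * t powr \<alpha>) ^ r / Gamma (\<alpha> * real r + \<alpha>))" for r
      proof -
        have "t powr (\<alpha> * real r + \<alpha> - 1) = t powr (\<alpha> * real r) * t powr (\<alpha> - 1)"
          by (simp add: add_diff_eq flip: powr_add)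
        also have "t powr (\<alpha> * real r) = (t powr \<alpha>) ^ r"
          using True by (simp add: powr_powr[symmetric] powr_realpow)
        finally have "t powr (\<alpha> * real r + \<alpha> - 1) = (t powr \<alpha>) ^ r * t powr (\<alpha> - 1)" .
        thus ?thesis using True
          by (simp only: c_def G_def d_def power_mult_distrib) simp
      qed
      have "summable (\<lambda>r. d * ((- \<theta> * t powr \<alpha>) ^ r / Gamma (\<alpha> * real r + \<alpha>)))"
        using summable_norm_cancel[OF s] unfolding eq .
      hence "summable (\<lambda>r. ((- \<theta> * t powr \<alpha>) ^ r / Gamma (\<alpha> * real r + \<alpha>)))"
        by (rule summable_mult_D[OF _ d])
      hence "(\<Sum>r. c r * G r t) = d * (\<Sum>r. (- \<theta> * t powr \<alpha>) ^ r / Gamma (\<alpha> * real r + \<alpha>))"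
        unfolding eq by (rule suminf_mult)
      thus ?thesis using True by (simp add: d_def ml_waiting_density_def mittag_leffler_def)
    qed (simp add: G_def ml_waiting_density_def)
  qed
  have meas: "(\<lambda>t. ml_waiting_density \<alpha> \<theta> t * exp (- (u * t))) \<in> borel_measurable lborel"
    unfolding ml_waiting_density_def mittag_leffler_def by measurable
  show ?thesis
    unfolding has_bochner_integral_iff
    using integrable_cong_AE_imp[OF 1 meas] AEeq integral_cong_AE[OF _ meas AEeq] 1 2 by (auto simp: eq_commute)
qed

lemma ml_waiting_density_measurable [measurable]: "ml_waiting_density \<alpha> \<theta> \<in> borel_measurable borel"
  unfolding ml_waiting_density_def mittag_leffler_def by measurable

lemma has_bochner_integral_ml_waiting_density_fdiff:
  assumes "0 < \<alpha>" "\<theta> > 0" "u > 0" "u powr \<alpha> > \<theta>"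
  shows "has_bochner_integral lborel
           (\<lambda>t. ml_waiting_density \<alpha> \<theta> t * (exp (- (u * t)) * (1 - exp (- t)) ^ k))
           ((fdiff ^^ k) (\<lambda>x. \<theta> / (\<theta> + x powr \<alpha>)) u)"
  using assms(3,4)
proof (induction k arbitrary: u)
  case 0
  then show ?case using has_bochner_integral_ml_waiting_density_exp[OF assms(1,2)] by simp
next
  case (Suc k)
  have "u powr \<alpha> \<le> (u + 1) powr \<alpha>" using Suc.prems assms by (intro powr_mono2) auto
  with Suc have "has_bochner_integral lborel
    (\<lambda>t. ml_waiting_density \<alpha> \<theta> t * (exp (- (u * t)) * (1 - exp (- t)) ^ k) -
         ml_waiting_density \<alpha> \<theta> t * (exp (- ((u + 1) * t)) * (1 - exp (- t)) ^ k))
    ((fdiff ^^ k) (\<lambda>x. \<theta> / (\<theta> + x powr \<alpha>)) u - (fdiff ^^ k) (\<lambda>x. \<theta> / (\<theta> + x powr \<alpha>)) (u + 1))"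
    by (intro has_bochner_integral_diff Suc.IH) auto
  also have "(\<lambda>t. ml_waiting_density \<alpha> \<theta> t * (exp (- (u * t)) * (1 - exp (- t)) ^ k) -
         ml_waiting_density \<alpha> \<theta> t * (exp (- ((u + 1) * t)) * (1 - exp (- t)) ^ k)) =
      (\<lambda>t. ml_waiting_density \<alpha> \<theta> t * (exp (- (u * t)) * (1 - exp (- t)) ^ Suc k))"
    by (rule ext) (simp add: algebra_simps flip: exp_add)
  finally show ?case by (simp add: fdiff_def[of "(fdiff ^^ k) g" for g])
qed

text \<open>
  A signed density whose moments against \<open>x\<^sup>j (1 - x)\<^sup>k\<close>, \<open>x = exp (- t)\<close>, are nonnegative is nonnegative
  on Bernstein polynomials of nonnegative functions, hence on nonnegative continuous functions.
\<close>
lemma integral_continuous_exp_nonneg: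
  fixes g h :: "real \<Rightarrow> real"
  assumes g: "integrable lborel g" and g0: "\<And>t. t \<le> 0 \<Longrightarrow> g t = 0"
    and mom: "\<And>j k. (\<integral>t. g t * (exp (- t) ^ j * (1 - exp (- t)) ^ k) \<partial>lborel) \<ge> 0"
    and h: "continuous_on UNIV h" "\<And>x. h x \<ge> 0"
  shows "(\<integral>t. g t * h (exp (- t)) \<partial>lborel) \<ge> 0"
proof -
  have [measurable]: "g \<in> borel_measurable borel" using g by simp
  have [measurable]: "h \<in> borel_measurable borel"
    using h(1) by (rule borel_measurable_continuous_onI)
  define C where "C = (\<integral>t. \<bar>g t\<bar> \<partial>lborel)"
  have C: "C \<ge> 0" by (auto simp: C_def)
  have integrable_bdd: "integrable lborel (\<lambda>t. g t * p (exp (- t)))"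
    if p: "continuous_on UNIV p" for p :: "real \<Rightarrow> real"
  proof -
    have [measurable]: "p \<in> borel_measurable borel" using p by (rule borel_measurable_continuous_onI)
    have "compact (p ` {0..1})" by (intro compact_continuous_image continuous_on_subset[OF p]) auto
    hence "bounded (p ` {0..1})" by (rule compact_imp_bounded)
    then obtain B where "\<forall>y\<in>p ` {0..1}. norm y \<le> B" unfolding bounded_iff by blast
    hence B: "\<bar>p x\<bar> \<le> B" if "x \<in> {0..1}" for x using that by auto
    have B0: "B \<ge> 0" using B[of 0] by (simp add: abs_le_iff) 
    show ?thesis
    proof (rule Bochner_Integration.integrable_bound[where f = "\<lambda>t. B * \<bar>g t\<bar>"])
      show "AE t in lborel. norm (g t * p (exp (- t))) \<le> norm (B * \<bar>g t\<bar>)"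
      proof (rule AE_I2)
        fix t :: real
        show "norm (g t * p (exp (- t))) \<le> norm (B * \<bar>g t\<bar>)"
        proof (cases "t \<le> 0")
          case False
          hence "\<bar>p (exp (- t))\<bar> \<le> B" by (intro B) auto
          thus ?thesis using B0 by (simp add: abs_mult mult.commute[of B] mult_left_mono)
        qed (simp add: g0)
      qed
    qed (use g in auto)
  qed
  have "(\<integral>t. g t * h (exp (- t)) \<partial>lborel) \<ge> - (e * C)" if e: "e > 0" for e
  proof -
    obtain N where N: "\<And>n x. N \<le> n \<Longrightarrow> x \<in> {0..1} \<Longrightarrow>
        \<bar>h x - (\<Sum>k\<le>n. h (real k / real n) * Bernstein n k x)\<bar> < e"
      using Bernstein_Weierstrass[OF continuous_on_subset[OF h(1)] e] by blast
    define p where "p x = (\<Sum>k\<le>N. h (real k / real N) * Bernstein N k x)" for x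
    have pc: "continuous_on UNIV p" unfolding p_def Bernstein_def by (intro continuous_intros)
    have [measurable]: "p \<in> borel_measurable borel" using pc by (rule borel_measurable_continuous_onI)
    have bern_int: "integrable lborel (\<lambda>t. g t * Bernstein N k (exp (- t)))" for k
      by (rule integrable_bdd) (auto simp: Bernstein_def intro!: continuous_intros)
    have p_nonneg: "(\<integral>t. g t * p (exp (- t)) \<partial>lborel) \<ge> 0"
    proof -
      have "(\<lambda>t. g t * p (exp (- t))) = (\<lambda>t. \<Sum>k\<le>N. h (real k / real N) * (g t * Bernstein N k (exp (- t))))"
        by (auto simp: p_def sum_distrib_left mult_ac)
      hence "(\<integral>t. g t * p (exp (- t)) \<partial>lborel) =
          (\<Sum>k\<le>N. h (real k / real N) * (\<integral>t. g t * Bernstein N k (exp (- t)) \<partial>lborel))"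
        using bern_int by (simp add: Bochner_Integration.integral_sum)
      also have "\<dots> \<ge> 0"
      proof (intro sum_nonneg mult_nonneg_nonneg h(2))
        fix k
        have "(\<lambda>t. g t * Bernstein N k (exp (- t))) =
            (\<lambda>t. real (N choose k) * (g t * (exp (- t) ^ k * (1 - exp (- t)) ^ (N - k))))"
          by (auto simp: Bernstein_def mult_ac)
        thus "(\<integral>t. g t * Bernstein N k (exp (- t)) \<partial>lborel) \<ge> 0"
          using mom[of k "N - k"] by simp
      qed
      finally show ?thesis .
    qed
    have "\<bar>(\<integral>t. g t * h (exp (- t)) \<partial>lborel) - (\<integral>t. g t * p (exp (- t)) \<partial>lborel)\<bar>
        = \<bar>\<integral>t. g t * h (exp (- t)) - g t * p (exp (- t)) \<partial>lborel\<bar>"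
      using integrable_bdd[OF h(1)] integrable_bdd[OF pc] by simp
    also have "\<dots> \<le> (\<integral>t. e * \<bar>g t\<bar> \<partial>lborel)"
    proof (rule integral_abs_bound_integral)
      show "integrable lborel (\<lambda>t. g t * h (exp (- t)) - g t * p (exp (- t)))"
        using integrable_bdd[OF h(1)] integrable_bdd[OF pc] by simp
      fix t :: real
      show "\<bar>g t * h (exp (- t)) - g t * p (exp (- t))\<bar> \<le> e * \<bar>g t\<bar>"
      proof (cases "t \<le> 0")
        case False
        hence "\<bar>h (exp (- t)) - p (exp (- t))\<bar> < e" unfolding p_def by (intro N) auto
        hence "\<bar>g t\<bar> * \<bar>h (exp (- t)) - p (exp (- t))\<bar> \<le> \<bar>g t\<bar> * e"
          by (intro mult_left_mono) auto
        thus ?thesis by (simp add: abs_mult[symmetric] right_diff_distrib mult.commute)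
      qed (simp add: g0)
    qed (use g in auto)
    also have "\<dots> = e * C" by (simp add: C_def)
    finally show ?thesis using p_nonneg by linarith
  qed
  note bound = this
  show ?thesis
  proof (rule ccontr)
    assume neg: "\<not> ?thesis"
    define I where "I = (\<integral>t. g t * h (exp (- t)) \<partial>lborel)"
    have I: "I < 0" using neg by (simp add: I_def)
    define e where "e = (- I / 2) / (C + 1)"
    have e: "e > 0" unfolding e_def using I C by (intro divide_pos_pos) auto
    have "e * C \<le> e * (C + 1)" using e by simp
    also have "\<dots> = - I / 2"
      unfolding e_def using C by (intro nonzero_eq_divide_eq[THEN iffD1, OF _ refl]) auto
    finally have "I \<ge> I / 2" using bound[OF e] by (simp add: I_def)
    thus False using I by simp
  qed
qed

text \<open>
  By inner regularity it is enough that the negative part gives no mass to compact subsets of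
  \<open>{t. g t < 0}\<close>; the indicator of such a set is a decreasing limit of continuous functions of \<open>exp (- t)\<close>.
\<close>
lemma AE_nonneg_of_exp_moments_nonneg:
  fixes g :: "real \<Rightarrow> real"
  assumes g: "integrable lborel g" and g0: "\<And>t. t \<le> 0 \<Longrightarrow> g t = 0"
    and mom: "\<And>j k. (\<integral>t. g t * (exp (- t) ^ j * (1 - exp (- t)) ^ k) \<partial>lborel) \<ge> 0"
  shows "AE t in lborel. g t \<ge> 0"
proof -
  have [measurable]: "g \<in> borel_measurable borel" using g by simp
  define B where "B = {t. g t < 0}"
  have B [measurable]: "B \<in> sets borel" unfolding B_def by measurable
  define \<nu> where "\<nu> = density lborel (\<lambda>t. ennreal (- g t))"
  have fin: "emeasure \<nu> (space \<nu>) \<noteq> \<infinity>"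
  proof -
    have "emeasure \<nu> (space \<nu>) = (\<integral>\<^sup>+t. ennreal (- g t) \<partial>lborel)"
      by (simp add: \<nu>_def emeasure_density)
    thus ?thesis using integrableD(3)[OF g] by simp
  qed
  have K0: "emeasure \<nu> K = 0" if K: "K \<subseteq> B" "compact K" for K
  proof (cases "K = {}")
    case False
    define K' where "K' = (\<lambda>t. exp (- t)) ` K"
    have K': "closed K'" "K' \<noteq> {}"
      unfolding K'_def using K(2) False
      by (auto intro!: compact_imp_closed compact_continuous_image continuous_intros)
    have inK: "exp (- t) \<in> K' \<longleftrightarrow> t \<in> K" for t by (auto simp: K'_def)
    have [measurable]: "K \<in> sets borel" using K(2) by (simp add: borel_compact)
    define h where "h n x = max 0 (1 - real n * infdist x K')" for n x
    have hc: "continuous_on UNIV (h n)" for n unfolding h_def by (intro continuous_intros)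
    have [measurable]: "h n \<in> borel_measurable borel" for n
      using hc by (rule borel_measurable_continuous_onI)
    have hlim: "(\<lambda>n. h n x) \<longlonglongrightarrow> indicator K' x" for x
    proof (cases "x \<in> K'")
      case True
      thus ?thesis by (simp add: h_def)
    next
      case False
      hence pos: "infdist x K' > 0"
        using K' in_closed_iff_infdist_zero[of K' x] infdist_nonneg[of x K'] by linarith
      have "eventually (\<lambda>n. real n \<ge> 1 / infdist x K') sequentially"
        using filterlim_real_sequentially by (simp add: filterlim_at_top)
      hence "eventually (\<lambda>n. h n x = 0) sequentially"
        by eventually_elim (use pos in \<open>auto simp: h_def field_simps\<close>)
      thus ?thesis using False by (simp add: tendsto_eventually)
    qed
    have "(\<lambda>n. \<integral>t. g t * h n (exp (- t)) \<partial>lborel) \<longlonglongrightarrow> (\<integral>t. g t * indicator K' (exp (- t)) \<partial>lborel)"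
    proof (rule integral_dominated_convergence[where w = "\<lambda>t. \<bar>g t\<bar>"])
      show "AE t in lborel. norm (g t * h n (exp (- t))) \<le> \<bar>g t\<bar>" for n
      proof (rule AE_I2)
        fix t
        have "\<bar>h n (exp (- t))\<bar> \<le> 1" using infdist_nonneg[of "exp (- t)" K'] by (auto simp: h_def)
        thus "norm (g t * h n (exp (- t))) \<le> \<bar>g t\<bar>"
          by (simp add: abs_mult mult_left_le)
      qed
      show "AE t in lborel. (\<lambda>n. g t * h n (exp (- t))) \<longlonglongrightarrow> g t * indicator K' (exp (- t))"
        by (intro AE_I2 tendsto_intros hlim)
      show "(\<lambda>t. g t * indicator K' (exp (- t))) \<in> borel_measurable lborel"
        using inK by (simp add: indicator_def)
    qed (use g in auto)
    moreover have "(\<integral>t. g t * h n (exp (- t)) \<partial>lborel) \<ge> 0" for n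
      by (rule integral_continuous_exp_nonneg[OF g g0 mom hc]) (auto simp: h_def)
    ultimately have "(\<integral>t. g t * indicator K' (exp (- t)) \<partial>lborel) \<ge> 0"
      by (intro LIMSEQ_le_const) auto
    also have "(\<lambda>t. g t * indicator K' (exp (- t))) = (\<lambda>t. - (- g t * indicator K t))"
      using inK by (auto simp: indicator_def)
    finally have le0: "(\<integral>t. - g t * indicator K t \<partial>lborel) \<le> 0" by simp
    have nn: "- g t * indicator K t \<ge> 0" for t
      using K(1) by (auto simp: indicator_def B_def)
    have "emeasure \<nu> K = (\<integral>\<^sup>+t. ennreal (- g t * indicator K t) \<partial>lborel)"
      by (auto simp: \<nu>_def emeasure_density indicator_def intro!: nn_integral_cong)
    also have "\<dots> = ennreal (\<integral>t. - g t * indicator K t \<partial>lborel)"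
    proof (rule nn_integral_eq_integral)
      show "integrable lborel (\<lambda>t. - g t * indicator K t)"
        using integrable_mult_indicator[of K lborel "\<lambda>t. - g t"] g by (simp add: mult.commute)
    qed (use nn in auto)
    also have "\<dots> = 0" using le0 by (simp add: ennreal_neg)
    finally show ?thesis .
  qed simp
  have "emeasure \<nu> B = (SUP K \<in> {K. K \<subseteq> B \<and> compact K}. emeasure \<nu> K)"
    by (rule inner_regular[OF _ fin B]) (simp add: \<nu>_def)
  also have "\<dots> \<le> 0" using K0 by (intro SUP_least) auto
  finally have "emeasure \<nu> B = 0" by simp
  hence "(\<integral>\<^sup>+t. ennreal (- g t) * indicator B t \<partial>lborel) = 0"
    by (simp add: \<nu>_def emeasure_density)
  hence "AE t in lborel. ennreal (- g t) * indicator B t = 0"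
    by (subst (asm) nn_integral_0_iff_AE) auto
  thus ?thesis
    by eventually_elim (auto simp: B_def indicator_def ennreal_eq_0_iff split: if_splits)
qed

lemma AE_ml_waiting_density_nonneg:
  assumes "0 < \<alpha>" "\<alpha> \<le> 1" "\<theta> > 0"
  shows "AE t in lborel. ml_waiting_density \<alpha> \<theta> t \<ge> 0"
proof -
  \<comment> \<open>Any \<open>u\<close> with \<open>u powr \<alpha> > \<theta>\<close> would do.\<close>
  define u where "u = (\<theta> + 1) powr (1 / \<alpha>)"
  have u: "u > 0" "u powr \<alpha> > \<theta>" using assms by (auto simp: u_def powr_powr)
  have uj: "(u + real j) powr \<alpha> > \<theta>" for j
    using u(2) powr_mono2[of \<alpha> u "u + real j"] u(1) assms by simp
  define g where "g t = ml_waiting_density \<alpha> \<theta> t * exp (- (u * t))" for t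
  have "AE t in lborel. g t \<ge> 0"
  proof (rule AE_nonneg_of_exp_moments_nonneg)
    show "integrable lborel g"
      using has_bochner_integral_ml_waiting_density_exp[OF assms(1,3) u]
      unfolding g_def by (rule integrable.intros)
    show "g t = 0" if "t \<le> 0" for t using that by (simp add: g_def ml_waiting_density_def)
    fix j k :: nat
    have eq: "(\<lambda>t. g t * (exp (- t) ^ j * (1 - exp (- t)) ^ k)) =
        (\<lambda>t. ml_waiting_density \<alpha> \<theta> t * (exp (- ((u + real j) * t)) * (1 - exp (- t)) ^ k))"
      by (rule ext) (simp add: g_def exp_of_nat_mult[symmetric] algebra_simps flip: exp_add)
    show "(\<integral>t. g t * (exp (- t) ^ j * (1 - exp (- t)) ^ k) \<partial>lborel) \<ge> 0"
      unfolding eq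
      using has_bochner_integral_ml_waiting_density_fdiff[OF assms(1,3) _ uj[of j], of k] u(1)
        fdiff_pow_laplace_nonneg[OF assms, of "u + real j" k]
      by (simp add: has_bochner_integral_iff)
  qed
  thus ?thesis by eventually_elim (simp add: g_def zero_le_mult_iff)
qed

section \<open>The Laplace transform of the waiting time\<close>

text \<open>
  Expansion of a weighted moment generating function in powers of \<open>h\<close>. It is used with the weight
  \<open>exp (- (u * S x))\<close> for the Laplace transform of \<open>S\<close>, and with weight \<open>1\<close> for \<open>ln S\<close>.
\<close>
lemma sums_integral_exp:
  fixes w X :: "'a \<Rightarrow> real"
  assumes meas [measurable]: "w \<in> borel_measurable M" "X \<in> borel_measurable M"
    and w: "\<And>x. w x \<ge> 0" and int: "integrable M (\<lambda>x. w x * exp (r * \<bar>X x\<bar>))"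
    and r: "r > 0"
  shows "integrable M (\<lambda>x. w x * X x ^ k)" (is ?int)
    and "\<bar>h\<bar> \<le> r \<Longrightarrow> (\<lambda>k. (\<integral>x. w x * X x ^ k \<partial>M) / fact k * h ^ k) sums (\<integral>x. w x * exp (h * X x) \<partial>M)"
proof -
  have exp_sums: "(\<lambda>k. y ^ k / fact k) sums exp y" for y :: real
    using exp_converges[of y] by (simp add: divide_inverse mult.commute)
  have term_le: "y ^ k / fact k \<le> exp y" if "y \<ge> 0" for y :: real and k
    using sum_le_suminf[of "\<lambda>k. y ^ k / fact k" "{k}"] exp_sums[of y] that by (simp add: sums_iff)
  have intk: "integrable M (\<lambda>x. w x * X x ^ k)" for k :: nat
  proof (rule Bochner_Integration.integrable_bound)
    show "integrable M (\<lambda>x. fact k / r ^ k * (w x * exp (r * \<bar>X x\<bar>)))"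
      using int by simp
    show "AE x in M. norm (w x * X x ^ k) \<le> norm (fact k / r ^ k * (w x * exp (r * \<bar>X x\<bar>)))"
    proof (rule AE_I2)
      fix x
      have "\<bar>X x\<bar> ^ k \<le> fact k / r ^ k * exp (r * \<bar>X x\<bar>)"
        using term_le[of "r * \<bar>X x\<bar>" k] r by (simp add: field_simps power_mult_distrib)
      hence "w x * \<bar>X x\<bar> ^ k \<le> w x * (fact k / r ^ k * exp (r * \<bar>X x\<bar>))"
        by (rule mult_left_mono) (rule w)
      thus "norm (w x * X x ^ k) \<le> norm (fact k / r ^ k * (w x * exp (r * \<bar>X x\<bar>)))"
        using w[of x] r by (simp add: abs_mult power_abs mult_ac)
    qed
  qed measurable
  show ?int by (rule intk)
  assume h: "\<bar>h\<bar> \<le> r"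
  let ?f = "\<lambda>k x. w x * X x ^ k / fact k * h ^ k"
  have fint: "integrable M (?f k)" for k
    using intk[of k] by simp
  have norm_sums: "(\<lambda>k. norm (?f k x)) sums (w x * exp (\<bar>h\<bar> * \<bar>X x\<bar>))" for x
    using sums_mult[OF exp_sums[of "\<bar>h\<bar> * \<bar>X x\<bar>"], of "w x"] w[of x]
    by (simp add: abs_mult power_abs power_mult_distrib mult_ac)
  have f_sums: "(\<lambda>k. ?f k x) sums (w x * exp (h * X x))" for x
    using sums_mult[OF exp_sums[of "h * X x"], of "w x"]
    by (simp add: power_mult_distrib mult_ac)
  have sum_int: "summable (\<lambda>k. \<integral>x. norm (?f k x) \<partial>M)"
  proof (rule summableI_nonneg_bounded)
    show "(\<Sum>k<n. \<integral>x. norm (?f k x) \<partial>M) \<le> (\<integral>x. w x * exp (r * \<bar>X x\<bar>) \<partial>M)" for n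
    proof -
      have "(\<Sum>k<n. \<integral>x. norm (?f k x) \<partial>M) = (\<integral>x. (\<Sum>k<n. norm (?f k x)) \<partial>M)"
        by (rule Bochner_Integration.integral_sum[symmetric]) (intro integrable_norm fint)
      also have "\<dots> \<le> (\<integral>x. w x * exp (r * \<bar>X x\<bar>) \<partial>M)"
      proof (rule integral_mono)
        show "integrable M (\<lambda>x. \<Sum>k<n. norm (?f k x))"
          by (intro Bochner_Integration.integrable_sum integrable_norm fint)
        fix x
        have "(\<Sum>k<n. norm (?f k x)) \<le> w x * exp (\<bar>h\<bar> * \<bar>X x\<bar>)"
          using sum_le_suminf[of "\<lambda>k. norm (?f k x)" "{..<n}"] norm_sums[of x] by (simp add: sums_iff)
        also have "\<dots> \<le> w x * exp (r * \<bar>X x\<bar>)"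
          using h w[of x] by (intro mult_left_mono) (auto intro: mult_right_mono)
        finally show "(\<Sum>k<n. norm (?f k x)) \<le> w x * exp (r * \<bar>X x\<bar>)" .
      qed fact
      finally show ?thesis .
    qed
  qed simp
  have "(\<lambda>k. integral\<^sup>L M (?f k)) sums (\<integral>x. (\<Sum>k. ?f k x) \<partial>M)"
    by (rule sums_integral[OF fint _ sum_int]) (use norm_sums in \<open>auto simp: sums_iff\<close>)
  moreover have "(\<Sum>k. ?f k x) = w x * exp (h * X x)" for x
    using f_sums[of x] by (simp add: sums_iff)
  moreover have "integral\<^sup>L M (?f k) = (\<integral>x. w x * X x ^ k \<partial>M) / fact k * h ^ k" for k
    by simp
  ultimately show "(\<lambda>k. (\<integral>x. w x * X x ^ k \<partial>M) / fact k * h ^ k) sums (\<integral>x. w x * exp (h * X x) \<partial>M)"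
    by simp
qed

lemma Re_powr_nonneg:
  assumes "Re z > 0" "0 < \<alpha>" "\<alpha> \<le> 1"
  shows "Re (z powr complex_of_real \<alpha>) \<ge> 0"
proof -
  have z: "z \<noteq> 0" using assms by auto
  have "\<bar>Im (Ln z)\<bar> < pi / 2" using assms z Re_Ln_pos_lt[of z] by simp
  hence "\<bar>\<alpha> * Im (Ln z)\<bar> < pi / 2"
    using assms mult_right_mono[of \<alpha> 1 "\<bar>Im (Ln z)\<bar>"] by (simp add: abs_mult)
  hence "cos (\<alpha> * Im (Ln z)) > 0" by (intro cos_gt_zero_pi) auto
  thus ?thesis using z by (simp add: powr_def Re_exp)
qed

context prob_space
begin

lemma laplace_transform_power_series:
  fixes S :: "'a \<Rightarrow> real"
  assumes S [measurable]: "S \<in> borel_measurable M" and pos: "AE x in M. S x > 0"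
    and u: "u > 0"
  shows "integrable M (\<lambda>x. S x ^ k * exp (- (u * S x)))"
    and "\<bar>h\<bar> < u \<Longrightarrow> (\<lambda>k. expectation (\<lambda>x. S x ^ k * exp (- (u * S x))) / fact k * h ^ k)
           sums expectation (\<lambda>x. exp (- ((u - h) * S x)))"
proof -
  have int: "integrable M (\<lambda>x. exp (- (u * S x)) * exp (r * \<bar>S x\<bar>))" if "r \<le> u" for r
  proof (rule Bochner_Integration.integrable_bound[where f = "\<lambda>_. 1 :: real"])
    show "AE x in M. norm (exp (- (u * S x)) * exp (r * \<bar>S x\<bar>)) \<le> norm (1 :: real)"
      using pos
    proof eventually_elim
      case (elim x)
      have "r * S x \<le> u * S x" using elim that by (intro mult_right_mono) auto
      thus ?case using elim by (simp flip: exp_add)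
    qed
  qed auto
  show "integrable M (\<lambda>x. S x ^ k * exp (- (u * S x)))"
    using sums_integral_exp(1)[OF _ S _ int[of u] u, of k] by (simp add: mult.commute)
  assume h: "\<bar>h\<bar> < u"
  have "(\<lambda>k. expectation (\<lambda>x. exp (- (u * S x)) * S x ^ k) / fact k * h ^ k)
           sums expectation (\<lambda>x. exp (- (u * S x)) * exp (h * S x))"
    by (rule sums_integral_exp(2)[OF _ S _ int[of u] u]) (use h in auto)
  thus "(\<lambda>k. expectation (\<lambda>x. S x ^ k * exp (- (u * S x))) / fact k * h ^ k)
           sums expectation (\<lambda>x. exp (- ((u - h) * S x)))"
    by (simp add: mult.commute algebra_simps flip: exp_add)
qed

text \<open>
  The Laplace transform has a power series about any point \<open>u1\<close> with radius of convergence at least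
  \<open>u1\<close>, and \<open>\<theta> / (\<theta> + z powr \<alpha>)\<close> is holomorphic on the right half plane since \<open>z powr \<alpha>\<close> has nonnegative real part
  there (this uses \<open>\<alpha> \<le> 1\<close>). If the two agree near \<open>u1\<close>, they agree on all of \<open>{0<..<u1}\<close>.
\<close>
lemma laplace_transform_extend:
  fixes S :: "'a \<Rightarrow> real"
  assumes S [measurable]: "S \<in> borel_measurable M" and pos: "AE x in M. S x > 0"
    and \<alpha>: "0 < \<alpha>" "\<alpha> \<le> 1" and \<theta>: "\<theta> > 0"
    and u0: "\<And>u. u > u0 \<Longrightarrow> expectation (\<lambda>x. exp (- (u * S x))) = \<theta> / (\<theta> + u powr \<alpha>)"
    and u: "u > 0"
  shows "expectation (\<lambda>x. exp (- (u * S x))) = \<theta> / (\<theta> + u powr \<alpha>)"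
proof (cases "u > u0")
  case False
  \<comment> \<open>The distance from \<open>u1\<close> to \<open>u\<close> must stay below \<open>u1\<close>, and \<open>u1\<close> must exceed \<open>u0\<close>.\<close>
  define u1 where "u1 = \<bar>u0\<bar> + u + 1"
  have u1: "u1 > 0" "u1 > u0" "u1 - u < u1" "u1 - u > 0" using u False by (auto simp: u1_def)
  define a where "a k = expectation (\<lambda>x. S x ^ k * exp (- (u1 * S x))) / fact k" for k
  have a: "(\<lambda>k. a k * h ^ k) sums expectation (\<lambda>x. exp (- ((u1 - h) * S x)))" if "\<bar>h\<bar> < u1" for h
    unfolding a_def by (rule laplace_transform_power_series(2)[OF S pos u1(1) that])
  have a0: "a k \<ge> 0" for k
    unfolding a_def using pos by (auto intro!: divide_nonneg_nonneg integral_nonneg_AE)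
  define G where "G z = (\<Sum>k. complex_of_real (a k) * z ^ k)" for z
  define H where "H z = complex_of_real \<theta> / (complex_of_real \<theta> + (complex_of_real u1 - z) powr complex_of_real \<alpha>)" for z
  have G_sums: "(\<lambda>k. complex_of_real (a k) * z ^ k) sums G z" if "norm z < u1" for z
  proof -
    have "summable (\<lambda>k. norm (complex_of_real (a k) * z ^ k))"
      using sums_summable[OF a[of "norm z"]] that a0 by (simp add: norm_mult norm_power)
    thus ?thesis unfolding G_def by (rule summable_sums[OF summable_norm_cancel])
  qed
  have G_real: "G (complex_of_real h) = complex_of_real (expectation (\<lambda>x. exp (- ((u1 - h) * S x))))"
    if "\<bar>h\<bar> < u1" for h
  proof -
    have "(\<lambda>k. complex_of_real (a k) * complex_of_real h ^ k) sums
        complex_of_real (expectation (\<lambda>x. exp (- ((u1 - h) * S x))))"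
      using sums_of_real[OF a[OF that], where ?'a = complex] by simp
    moreover have "(\<lambda>k. complex_of_real (a k) * complex_of_real h ^ k) sums G (complex_of_real h)"
      using that by (intro G_sums) simp
    ultimately show ?thesis by (rule sums_unique2[symmetric])
  qed
  have H_real: "H (complex_of_real h) = complex_of_real (\<theta> / (\<theta> + (u1 - h) powr \<alpha>))"
    if "\<bar>h\<bar> < u1" for h
    using that powr_of_real[of "u1 - h" \<alpha>] by (simp add: H_def flip: of_real_diff)
  have Gh: "G holomorphic_on ball 0 u1"
    by (rule power_series_holomorphic[where a = "\<lambda>k. complex_of_real (a k)"]) (use G_sums in auto)
  have Re_pos: "Re (complex_of_real u1 - z) > 0" if "z \<in> ball 0 u1" for z
    using that abs_Re_le_cmod[of z] by simp
  have Hh: "H holomorphic_on ball 0 u1"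
    unfolding H_def
  proof (intro holomorphic_intros)
    fix z :: complex assume z: "z \<in> ball 0 u1"
    show "complex_of_real u1 - z \<notin> \<real>\<^sub>\<le>\<^sub>0"
      using Re_pos[OF z] by (auto simp: complex_nonpos_Reals_iff)
    have "Re (complex_of_real \<theta> + (complex_of_real u1 - z) powr complex_of_real \<alpha>) > 0"
      using Re_powr_nonneg[OF Re_pos[OF z] \<alpha>] \<theta> by simp
    thus "complex_of_real \<theta> + (complex_of_real u1 - z) powr complex_of_real \<alpha> \<noteq> 0"
      by (metis less_irrefl zero_complex.sel(1))
  qed
  define d where "d = min u1 (u1 - u0)"
  have d: "d > 0" using u1 by (simp add: d_def)
  have "G (complex_of_real (u1 - u)) - H (complex_of_real (u1 - u)) = 0"
  proof (rule analytic_continuation[of "\<lambda>z. G z - H z" "ball 0 u1" "complex_of_real ` {0<..<d}" 0])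
    show "(\<lambda>z. G z - H z) holomorphic_on ball 0 u1" by (intro holomorphic_intros Gh Hh)
    show "complex_of_real ` {0<..<d} \<subseteq> ball 0 u1" by (auto simp: d_def)
    show "(0 :: complex) islimpt complex_of_real ` {0<..<d}"
      unfolding islimpt_approachable
    proof (intro allI impI)
      fix e :: real assume e: "e > 0"
      define x where "x = min (d / 2) (e / 2)"
      have "x > 0" "x < d" "x < e" using d e by (auto simp: x_def)
      thus "\<exists>x'\<in>complex_of_real ` {0<..<d}. x' \<noteq> 0 \<and> dist x' 0 < e"
        by (intro bexI[of _ "complex_of_real x"]) auto
    qed
    show "G z - H z = 0" if "z \<in> complex_of_real ` {0<..<d}" for z
    proof -
      from that obtain h where h: "z = complex_of_real h" "0 < h" "h < d" by auto
      have "expectation (\<lambda>x. exp (- ((u1 - h) * S x))) = \<theta> / (\<theta> + (u1 - h) powr \<alpha>)"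
        using h by (intro u0) (auto simp: d_def)
      thus ?thesis using G_real[of h] H_real[of h] h by (simp add: d_def)
    qed
    show "complex_of_real (u1 - u) \<in> ball 0 u1" using u1 by (simp del: of_real_diff)
  qed (use u1 in auto)
  hence "complex_of_real (expectation (\<lambda>x. exp (- ((u1 - (u1 - u)) * S x)))) =
      complex_of_real (\<theta> / (\<theta> + (u1 - (u1 - u)) powr \<alpha>))"
    using G_real[of "u1 - u"] H_real[of "u1 - u"] u1 by (simp del: of_real_diff of_real_divide)
  thus ?thesis by (simp only: of_real_eq_iff) simp
qed (rule u0)

text \<open>
  The value \<open>-L'(u)\<close> is read off as the linear coefficient of the power series of the Laplace transform
  about \<open>u\<close>, which is indexed by \<open>h\<close> with argument \<open>u - h\<close>; hence the sign.
\<close>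
lemma laplace_transform_derivative:
  fixes S :: "'a \<Rightarrow> real"
  assumes S [measurable]: "S \<in> borel_measurable M" and pos: "AE x in M. S x > 0"
    and \<alpha>: "0 < \<alpha>" and \<theta>: "\<theta> > 0"
    and L: "\<And>u. u > 0 \<Longrightarrow> expectation (\<lambda>x. exp (- (u * S x))) = \<theta> / (\<theta> + u powr \<alpha>)"
    and u: "u > 0"
  shows "has_bochner_integral M (\<lambda>x. S x * exp (- (u * S x)))
           (\<alpha> * \<theta> * u powr (\<alpha> - 1) / (\<theta> + u powr \<alpha>)\<^sup>2)"
proof -
  define a where "a k = expectation (\<lambda>x. S x ^ k * exp (- (u * S x))) / fact k" for k
  have a: "(\<lambda>k. a k * h ^ k) sums (\<theta> / (\<theta> + (u - h) powr \<alpha>))" if "\<bar>h\<bar> < u" for h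
    using laplace_transform_power_series(2)[OF S pos u that] L[of "u - h"] that
    unfolding a_def by simp
  have 1: "((\<lambda>h. \<Sum>k. a k * h ^ k) has_real_derivative (\<Sum>k. diffs a k * 0 ^ k)) (at 0)"
    by (rule termdiffs_strong'[where K = u]) (use a u in \<open>auto simp: sums_iff\<close>)
  have pos': "\<theta> + u powr \<alpha> > 0" using \<theta> by (simp add: add_pos_nonneg)
  have d: "((\<lambda>h. \<theta> + (u - h) powr \<alpha>) has_real_derivative (- (\<alpha> * u powr (\<alpha> - 1)))) (at 0)"
    using u by (auto intro!: derivative_eq_intros simp: powr_diff)
  have "((\<lambda>h. \<theta> / (\<theta> + (u - h) powr \<alpha>)) has_real_derivative
      (\<alpha> * \<theta> * u powr (\<alpha> - 1) / (\<theta> + u powr \<alpha>)\<^sup>2)) (at 0)"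
    using DERIV_divide[OF DERIV_const[of \<theta>] d] pos' by (simp add: power2_eq_square mult_ac)
  moreover have "\<forall>\<^sub>F h in nhds 0. \<theta> / (\<theta> + (u - h) powr \<alpha>) = (\<Sum>k. a k * h ^ k)"
  proof -
    have "\<forall>\<^sub>F h in nhds (0::real). h \<in> ball 0 u" using u by (intro eventually_nhds_in_open) auto
    thus ?thesis by eventually_elim (use a in \<open>auto simp: sums_iff\<close>)
  qed
  ultimately have 2: "((\<lambda>h. \<Sum>k. a k * h ^ k) has_real_derivative
      (\<alpha> * \<theta> * u powr (\<alpha> - 1) / (\<theta> + u powr \<alpha>)\<^sup>2)) (at 0)"
    by (subst (asm) DERIV_cong_ev) auto
  have "expectation (\<lambda>x. S x * exp (- (u * S x))) = \<alpha> * \<theta> * u powr (\<alpha> - 1) / (\<theta> + u powr \<alpha>)\<^sup>2"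
    using DERIV_unique[OF 1 2] unfolding powser_zero by (simp add: diffs_def a_def)
  thus ?thesis
    using laplace_transform_power_series(1)[OF S pos u, of 1] by (simp add: has_bochner_integral_iff)
qed

end

text \<open>
  The law of \<open>S\<close> is given by the positive part of \<open>ml_waiting_density\<close>; it agrees almost everywhere with
  the density itself, whose Laplace transform is known for large arguments.
\<close>
lemma ml_waiting_time_laplace:
  fixes S :: "'a \<Rightarrow> real"
  assumes "prob_space M" and \<alpha>: "0 < \<alpha>" "\<alpha> \<le> 1" and \<theta>: "\<theta> > 0"
    and S: "distributed M lborel S (\<lambda>t. ennreal (ml_waiting_density \<alpha> \<theta> t))"
  shows "AE x in M. S x > 0"
    and "u > 0 \<Longrightarrow> (\<integral>x. exp (- (u * S x)) \<partial>M) = \<theta> / (\<theta> + u powr \<alpha>)"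
proof -
  interpret prob_space M by fact
  have Sm: "S \<in> measurable M lborel" and Sd: "distr M lborel S = density lborel (\<lambda>t. ennreal (ml_waiting_density \<alpha> \<theta> t))"
    using S by (auto simp: distributed_def)
  have [measurable]: "S \<in> borel_measurable M" using Sm by simp
  have "AE t in density lborel (\<lambda>t. ennreal (ml_waiting_density \<alpha> \<theta> t)). t > 0"
    by (subst AE_density, measurable) (auto simp: ml_waiting_density_def)
  hence "AE t in distr M lborel S. t > 0" unfolding Sd .
  thus pos: "AE x in M. S x > 0" by (rule AE_distrD[OF Sm])
  define f where "f t = max 0 (ml_waiting_density \<alpha> \<theta> t)" for t
  have "(\<lambda>t. ennreal (ml_waiting_density \<alpha> \<theta> t)) = (\<lambda>t. ennreal (f t))"
    by (auto simp: f_def max_def ennreal_neg)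
  hence Sf: "distributed M lborel S (\<lambda>t. ennreal (f t))" using S by simp
  have large: "expectation (\<lambda>x. exp (- (u * S x))) = \<theta> / (\<theta> + u powr \<alpha>)"
    if u: "u > (\<theta> + 1) powr (1 / \<alpha>)" for u
  proof -
    have "((\<theta> + 1) powr (1 / \<alpha>)) powr \<alpha> < u powr \<alpha>" using u \<alpha> by (intro powr_less_mono2) auto
    hence "u powr \<alpha> > \<theta>" using \<alpha> \<theta> by (simp add: powr_powr)
    moreover have "u > 0" using u powr_ge_zero less_le_trans by (metis le_less_trans)
    ultimately have b: "has_bochner_integral lborel (\<lambda>t. ml_waiting_density \<alpha> \<theta> t * exp (- (u * t))) (\<theta> / (\<theta> + u powr \<alpha>))"
      using has_bochner_integral_ml_waiting_density_exp[OF \<alpha>(1) \<theta>] by simp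
    have "expectation (\<lambda>x. exp (- (u * S x))) = (\<integral>t. f t * exp (- (u * t)) \<partial>lborel)"
      by (rule distributed_integral[OF Sf, symmetric]) (auto simp: f_def)
    also have "\<dots> = (\<integral>t. ml_waiting_density \<alpha> \<theta> t * exp (- (u * t)) \<partial>lborel)"
    proof (rule integral_cong_AE)
      show "AE t in lborel. f t * exp (- (u * t)) = ml_waiting_density \<alpha> \<theta> t * exp (- (u * t))"
        using AE_ml_waiting_density_nonneg[OF \<alpha> \<theta>] by eventually_elim (simp add: f_def)
    qed (auto simp: f_def)
    also have "\<dots> = \<theta> / (\<theta> + u powr \<alpha>)" using b by (simp add: has_bochner_integral_iff)
    finally show ?thesis .
  qed
  show "expectation (\<lambda>x. exp (- (u * S x))) = \<theta> / (\<theta> + u powr \<alpha>)" if "u > 0"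
    by (rule laplace_transform_extend[OF _ pos \<alpha> \<theta> large that]) auto
qed

section \<open>Power moments of the waiting time\<close>

text \<open>
  The substitution \<open>v = u powr a\<close> on the half line. It is carried out on compact intervals inside it, where
  the derivative of \<open>u powr a\<close> is continuous, and extended by monotone convergence.
\<close>
lemma nn_integral_powr_substitution:
  fixes f :: "real \<Rightarrow> real"
  assumes [measurable]: "f \<in> borel_measurable borel" and f: "\<And>x. f x \<ge> 0" and a: "a > 0"
  shows "(\<integral>\<^sup>+u. ennreal (indicator {0<..} u * (f (u powr a) * (a * u powr (a - 1)))) \<partial>lborel)
       = (\<integral>\<^sup>+v. ennreal (indicator {0<..} v * f v) \<partial>lborel)"
proof -
  have pos: "inverse (real (Suc n)) > 0" for n by simp
  have le: "inverse (real (Suc n)) \<le> real (Suc n)" for n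
    by (metis inverse_le_1_iff le_add1 of_nat_1 of_nat_le_iff order.trans plus_1_eq_Suc)
  let ?A = "\<lambda>n::nat. {inverse (real (Suc n))..real (Suc n)}"
  have step: "(\<integral>\<^sup>+x. ennreal (f x) * indicator {inverse (real (Suc n)) powr a..real (Suc n) powr a} x \<partial>lborel)
      = (\<integral>\<^sup>+x. ennreal (f (x powr a) * (a * x powr (a - 1))) * indicator (?A n) x \<partial>lborel)" for n
  proof -
    have "(\<integral>\<^sup>+x. ennreal (f x * indicator {inverse (real (Suc n)) powr a..real (Suc n) powr a} x) \<partial>lborel)
      = (\<integral>\<^sup>+x. ennreal (f (x powr a) * (a * x powr (a - 1)) * indicator (?A n) x) \<partial>lborel)"
    proof (rule nn_integral_substitution[where g = "\<lambda>x. x powr a" and g' = "\<lambda>x. a * x powr (a - 1)"])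
      show "set_borel_measurable borel {inverse (real (Suc n)) powr a..real (Suc n) powr a} f"
        unfolding set_borel_measurable_def by measurable
      fix x assume x: "x \<in> ?A n"
      have x0: "x > 0" using less_le_trans[OF pos[of n], of x] x by (simp del: of_nat_Suc)
      show "((\<lambda>x. x powr a) has_real_derivative a * x powr (a - 1)) (at x)"
        using has_real_derivative_powr[OF x0] .
      show "a * x powr (a - 1) \<ge> 0" using a by simp
    next
      show "continuous_on (?A n) (\<lambda>x. a * x powr (a - 1))"
        using pos[of n] by (intro continuous_intros) (auto simp del: of_nat_Suc)
    qed (rule le)
    moreover have "ennreal (c * indicator A x) = ennreal c * indicator A x" for c x :: real and A
      by (auto simp: indicator_def)
    ultimately show ?thesis by simp
  qed
  have lim: "(\<lambda>n. \<integral>\<^sup>+x. ennreal (h x) * indicator {l n..r n} x \<partial>lborel)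
      \<longlonglongrightarrow> (\<integral>\<^sup>+x. ennreal (indicator {0<..} x * h x) \<partial>lborel)"
    if [measurable]: "h \<in> borel_measurable borel" and l: "decseq l" "\<And>n. l n > 0" "l \<longlonglongrightarrow> 0"
      and r: "incseq r" "filterlim r at_top sequentially"
    for h l r :: "_ \<Rightarrow> real"
  proof -
    have "(\<lambda>n. \<integral>\<^sup>+x. ennreal (h x) * indicator {l n..r n} x \<partial>lborel)
        \<longlonglongrightarrow> (SUP n. \<integral>\<^sup>+x. ennreal (h x) * indicator {l n..r n} x \<partial>lborel)"
    proof (rule LIMSEQ_SUP, rule incseq_SucI, rule nn_integral_mono)
      fix n x
      have "l (Suc n) \<le> l n" "r n \<le> r (Suc n)" using l(1) r(1) by (auto simp: decseq_Suc_iff incseq_Suc_iff)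
      thus "ennreal (h x) * indicator {l n..r n} x \<le> ennreal (h x) * indicator {l (Suc n)..r (Suc n)} x"
        by (intro mult_left_mono) (auto simp: indicator_def)
    qed
    also have "(SUP n. \<integral>\<^sup>+x. ennreal (h x) * indicator {l n..r n} x \<partial>lborel)
        = (\<integral>\<^sup>+x. (SUP n. ennreal (h x) * indicator {l n..r n} x) \<partial>lborel)"
    proof (rule nn_integral_monotone_convergence_SUP[symmetric])
      show "incseq (\<lambda>n x. ennreal (h x) * indicator {l n..r n} x)"
      proof (rule incseq_SucI, rule le_funI)
        fix n x
        have "l (Suc n) \<le> l n" "r n \<le> r (Suc n)" using l(1) r(1) by (auto simp: decseq_Suc_iff incseq_Suc_iff)
        thus "ennreal (h x) * indicator {l n..r n} x \<le> ennreal (h x) * indicator {l (Suc n)..r (Suc n)} x"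
          by (intro mult_left_mono) (auto simp: indicator_def)
      qed
    qed measurable
    also have "\<dots> = (\<integral>\<^sup>+x. ennreal (indicator {0<..} x * h x) \<partial>lborel)"
    proof (rule nn_integral_cong)
      fix x :: real
      show "(SUP n. ennreal (h x) * indicator {l n..r n} x) = ennreal (indicator {0<..} x * h x)"
      proof (cases "x > 0")
        case True
        have "eventually (\<lambda>n. l n < x) sequentially" using l(3) True by (rule order_tendstoD(2))
        moreover have "eventually (\<lambda>n. r n \<ge> x) sequentially" using r(2) by (auto simp: filterlim_at_top)
        ultimately have "eventually (\<lambda>n. x \<in> {l n..r n}) sequentially" by eventually_elim auto
        then obtain n where n: "x \<in> {l n..r n}" by (auto simp: eventually_sequentially)
        show ?thesis
        proof (rule antisym)
          show "(SUP n. ennreal (h x) * indicator {l n..r n} x) \<le> ennreal (indicator {0<..} x * h x)"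
            using True by (intro SUP_least) (auto simp: indicator_def)
          show "ennreal (indicator {0<..} x * h x) \<le> (SUP n. ennreal (h x) * indicator {l n..r n} x)"
            using True n by (intro SUP_upper2[of n]) auto
        qed
      next
        case False
        have "x \<notin> {l n..r n}" for n using l(2)[of n] False by auto
        thus ?thesis using False by simp
      qed
    qed
    finally show ?thesis .
  qed
  have inv_lim: "(\<lambda>n. inverse (real (Suc n))) \<longlonglongrightarrow> 0" by (rule LIMSEQ_inverse_real_of_nat)
  have suc_lim: "filterlim (\<lambda>n. real (Suc n)) at_top sequentially"
    by (rule filterlim_compose[OF filterlim_real_sequentially filterlim_Suc])
  have 1: "(\<lambda>n. \<integral>\<^sup>+x. ennreal (f x) * indicator {inverse (real (Suc n)) powr a..real (Suc n) powr a} x \<partial>lborel)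
      \<longlonglongrightarrow> (\<integral>\<^sup>+x. ennreal (indicator {0<..} x * f x) \<partial>lborel)"
  proof (rule lim)
    show "decseq (\<lambda>n. inverse (real (Suc n)) powr a)"
      using a by (intro decseq_SucI powr_mono2) auto
    show "incseq (\<lambda>n. real (Suc n) powr a)" using a by (intro incseq_SucI powr_mono2) auto
    show "(\<lambda>n. inverse (real (Suc n)) powr a) \<longlonglongrightarrow> 0"
      using tendsto_powr'[OF inv_lim tendsto_const[of a]] a by simp
    show "filterlim (\<lambda>n. real (Suc n) powr a) at_top sequentially"
      using a by (auto simp: powr_def intro!: filterlim_compose[OF exp_at_top]
        filterlim_tendsto_pos_mult_at_top[OF tendsto_const] filterlim_compose[OF ln_at_top] suc_lim
        simp del: of_nat_Suc)
  qed auto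
  have 2: "(\<lambda>n. \<integral>\<^sup>+x. ennreal (f (x powr a) * (a * x powr (a - 1))) * indicator (?A n) x \<partial>lborel)
      \<longlonglongrightarrow> (\<integral>\<^sup>+x. ennreal (indicator {0<..} x * (f (x powr a) * (a * x powr (a - 1)))) \<partial>lborel)"
    by (rule lim) (use inv_lim suc_lim in \<open>auto intro!: decseq_SucI incseq_SucI simp: field_simps\<close>)
  show ?thesis using LIMSEQ_unique[OF 1 2[folded step]] by simp
qed

text \<open>
  A beta integral, computed by writing \<open>1 / (\<theta> + v)\<^sup>2\<close> as the Laplace transform of \<open>y\<close> and applying
  Tonelli's theorem.
\<close>
lemma nn_integral_powr_cauchy_kernel:
  assumes "\<theta> > 0" "\<bar>s\<bar> < 1"
  shows "(\<integral>\<^sup>+v. ennreal (indicator {0<..} v * (v powr s * (\<theta> / (\<theta> + v)\<^sup>2))) \<partial>lborel)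
       = ennreal (\<theta> powr s * Gamma (1 + s) * Gamma (1 - s))"
proof -
  have kernel: "ennreal (indicator {0<..} v * (v powr s * (\<theta> / (\<theta> + v)\<^sup>2))) =
      (\<integral>\<^sup>+y. ennreal (\<theta> * indicator {0<..} v * v powr s * (indicator {0<..} y * (y * exp (- ((\<theta> + v) * y))))) \<partial>lborel)" for v
  proof (cases "v > 0")
    case True
    have "(\<integral>\<^sup>+y. ennreal (indicator {0<..} y * (y * exp (- ((\<theta> + v) * y)))) \<partial>lborel) =
        (\<integral>\<^sup>+y. ennreal (indicator {0<..} y * (y powr (2 - 1) * exp (- ((\<theta> + v) * y)))) \<partial>lborel)"
      by (intro nn_integral_cong) (auto simp: indicator_def)
    also have "\<dots> = ennreal (Gamma 2 / (\<theta> + v) powr 2)"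
      using True assms by (intro nn_integral_powr_exp) auto
    also have "\<dots> = ennreal (1 / (\<theta> + v)\<^sup>2)"
      using True assms Gamma_numeral[of "num.Bit0 num.One", where ?'a = real] by (simp add: powr_numeral)
    finally have I: "(\<integral>\<^sup>+y. ennreal (indicator {0<..} y * (y * exp (- ((\<theta> + v) * y)))) \<partial>lborel) = ennreal (1 / (\<theta> + v)\<^sup>2)" .
    have "(\<integral>\<^sup>+y. ennreal (\<theta> * indicator {0<..} v * v powr s * (indicator {0<..} y * (y * exp (- ((\<theta> + v) * y))))) \<partial>lborel)
      = (\<integral>\<^sup>+y. ennreal (\<theta> * v powr s) * ennreal (indicator {0<..} y * (y * exp (- ((\<theta> + v) * y)))) \<partial>lborel)"
      using True assms by (intro nn_integral_cong) (simp add: ennreal_mult')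
    also have "\<dots> = ennreal (\<theta> * v powr s) * ennreal (1 / (\<theta> + v)\<^sup>2)"
      by (subst nn_integral_cmult) (auto simp: I)
    also have "\<dots> = ennreal (indicator {0<..} v * (v powr s * (\<theta> / (\<theta> + v)\<^sup>2)))"
      using True assms by (simp add: mult.commute flip: ennreal_mult)
    finally show ?thesis by simp
  qed simp
  have inner: "(\<integral>\<^sup>+v. ennreal (\<theta> * indicator {0<..} v * v powr s * (indicator {0<..} y * (y * exp (- ((\<theta> + v) * y))))) \<partial>lborel)
      = ennreal (\<theta> * Gamma (1 + s)) * ennreal (indicator {0<..} y * (y powr ((1 - s) - 1) * exp (- (\<theta> * y))))" for y
  proof (cases "y > 0")
    case True
    have "(\<integral>\<^sup>+v. ennreal (\<theta> * indicator {0<..} v * v powr s * (indicator {0<..} y * (y * exp (- ((\<theta> + v) * y))))) \<partial>lborel)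
      = (\<integral>\<^sup>+v. ennreal (\<theta> * y * exp (- (\<theta> * y))) *
           ennreal (indicator {0<..} v * (v powr ((1 + s) - 1) * exp (- (y * v)))) \<partial>lborel)"
      using True assms
      by (intro nn_integral_cong) (auto simp: algebra_simps exp_add[symmetric] simp flip: ennreal_mult' )
    also have "\<dots> = ennreal (\<theta> * y * exp (- (\<theta> * y))) * ennreal (Gamma (1 + s) / y powr (1 + s))"
      by (subst nn_integral_cmult) (use nn_integral_powr_exp[of "1 + s" y] True assms in auto)
    also have "\<dots> = ennreal (\<theta> * Gamma (1 + s)) * ennreal (indicator {0<..} y * (y powr ((1 - s) - 1) * exp (- (\<theta> * y))))"
      using True assms Gamma_real_pos[of "1 + s"]
      by (simp add: powr_add powr_minus field_simps flip: ennreal_mult)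
    finally show ?thesis .
  qed simp
  have "(\<integral>\<^sup>+v. ennreal (indicator {0<..} v * (v powr s * (\<theta> / (\<theta> + v)\<^sup>2))) \<partial>lborel)
      = (\<integral>\<^sup>+y. \<integral>\<^sup>+v. ennreal (\<theta> * indicator {0<..} v * v powr s * (indicator {0<..} y * (y * exp (- ((\<theta> + v) * y))))) \<partial>lborel \<partial>lborel)"
    unfolding kernel by (rule lborel_pair.Fubini') measurable
  also have "\<dots> = ennreal (\<theta> * Gamma (1 + s)) * ennreal (Gamma (1 - s) / \<theta> powr (1 - s))"
    unfolding inner using assms
    by (subst nn_integral_cmult) (use nn_integral_powr_exp[of "1 - s" \<theta>] in auto)
  also have "\<dots> = ennreal (\<theta> powr s * Gamma (1 + s) * Gamma (1 - s))"
    using assms Gamma_real_pos[of "1 + s"] Gamma_real_pos[of "1 - s"]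
    by (simp add: powr_diff flip: ennreal_mult)
  finally show ?thesis .
qed

context prob_space
begin

text \<open>
  Both sides of \<open>E (S exp (- u S)) = - L'(u)\<close> are integrated against \<open>u powr (- r)\<close>: the left one gives
  \<open>\<Gamma>(1 - r) E (S powr r)\<close>, the right one a beta integral. Since everything is nonnegative, finiteness of the moment is
  part of the result, for positive and for negative \<open>r\<close>.
\<close>
lemma has_bochner_integral_powr_of_laplace:
  fixes S :: "'a \<Rightarrow> real"
  assumes S [measurable]: "S \<in> borel_measurable M" and pos: "AE x in M. S x > 0"
    and \<alpha>: "0 < \<alpha>" "\<alpha> \<le> 1" and \<theta>: "\<theta> > 0"
    and L: "\<And>u. u > 0 \<Longrightarrow> expectation (\<lambda>x. exp (- (u * S x))) = \<theta> / (\<theta> + u powr \<alpha>)"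
    and r: "\<bar>r\<bar> < \<alpha>"
  shows "has_bochner_integral M (\<lambda>x. S x powr r)
           (\<theta> powr (- (r / \<alpha>)) * Gamma (1 + r / \<alpha>) * Gamma (1 - r / \<alpha>) / Gamma (1 - r))"
proof -
  have r1: "1 - r > 0" and ra: "\<bar>- (r / \<alpha>)\<bar> < 1" using r \<alpha> by (auto simp: field_simps)
  note D = laplace_transform_derivative[OF S pos \<alpha>(1) \<theta> L]
  have "ennreal (Gamma (1 - r)) * (\<integral>\<^sup>+x. ennreal (S x powr r) \<partial>M) =
      (\<integral>\<^sup>+x. ennreal (Gamma (1 - r)) * ennreal (S x powr r) \<partial>M)"
    by (rule nn_integral_cmult[symmetric]) measurable
  also have "\<dots> = (\<integral>\<^sup>+x. \<integral>\<^sup>+u. ennreal (indicator {0<..} u * (u powr (- r) * (S x * exp (- (u * S x))))) \<partial>lborel \<partial>M)"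
  proof (rule nn_integral_cong_AE, use pos in eventually_elim)
    case (elim x)
    have "(\<integral>\<^sup>+u. ennreal (indicator {0<..} u * (u powr (- r) * (S x * exp (- (u * S x))))) \<partial>lborel)
      = (\<integral>\<^sup>+u. ennreal (S x) * ennreal (indicator {0<..} u * (u powr ((1 - r) - 1) * exp (- (S x * u)))) \<partial>lborel)"
      using elim by (intro nn_integral_cong) (simp add: mult_ac flip: ennreal_mult')
    also have "\<dots> = ennreal (S x) * ennreal (Gamma (1 - r) / S x powr (1 - r))"
      using nn_integral_powr_exp[OF r1 elim] by (subst nn_integral_cmult) auto
    also have "\<dots> = ennreal (Gamma (1 - r)) * ennreal (S x powr r)"
      using elim Gamma_real_pos[OF r1] by (simp add: powr_diff flip: ennreal_mult)
    finally show ?case ..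
  qed
  also have "\<dots> = (\<integral>\<^sup>+u. \<integral>\<^sup>+x. ennreal (indicator {0<..} u * (u powr (- r) * (S x * exp (- (u * S x))))) \<partial>M \<partial>lborel)"
  proof -
    interpret pair_sigma_finite M lborel ..
    show ?thesis by (rule Fubini'[symmetric]) measurable
  qed
  also have "\<dots> = (\<integral>\<^sup>+u. ennreal (indicator {0<..} u * ((u powr \<alpha>) powr (- (r / \<alpha>)) *
      (\<theta> / (\<theta> + u powr \<alpha>)\<^sup>2) * (\<alpha> * u powr (\<alpha> - 1)))) \<partial>lborel)"
  proof (rule nn_integral_cong)
    fix u :: real
    show "(\<integral>\<^sup>+x. ennreal (indicator {0<..} u * (u powr (- r) * (S x * exp (- (u * S x))))) \<partial>M) =
      ennreal (indicator {0<..} u * ((u powr \<alpha>) powr (- (r / \<alpha>)) *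
      (\<theta> / (\<theta> + u powr \<alpha>)\<^sup>2) * (\<alpha> * u powr (\<alpha> - 1))))"
    proof (cases "u > 0")
      case True
      have "(\<integral>\<^sup>+x. ennreal (indicator {0<..} u * (u powr (- r) * (S x * exp (- (u * S x))))) \<partial>M)
        = (\<integral>\<^sup>+x. ennreal (u powr (- r)) * ennreal (S x * exp (- (u * S x))) \<partial>M)"
        using True by (intro nn_integral_cong) (simp add: ennreal_mult')
      also have "\<dots> = ennreal (u powr (- r)) * ennreal (\<alpha> * \<theta> * u powr (\<alpha> - 1) / (\<theta> + u powr \<alpha>)\<^sup>2)"
      proof -
        have "(\<integral>\<^sup>+x. ennreal (S x * exp (- (u * S x))) \<partial>M) = ennreal (\<alpha> * \<theta> * u powr (\<alpha> - 1) / (\<theta> + u powr \<alpha>)\<^sup>2)"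
          using D[OF _ True] pos by (subst nn_integral_eq_integral) (auto simp: has_bochner_integral_iff)
        thus ?thesis by (subst nn_integral_cmult) auto
      qed
      also have "\<dots> = ennreal (indicator {0<..} u * ((u powr \<alpha>) powr (- (r / \<alpha>)) *
          (\<theta> / (\<theta> + u powr \<alpha>)\<^sup>2) * (\<alpha> * u powr (\<alpha> - 1))))"
        using True \<alpha> \<theta> by (simp add: powr_powr mult_ac flip: ennreal_mult)
      finally show ?thesis .
    qed simp
  qed
  also have "\<dots> = (\<integral>\<^sup>+v. ennreal (indicator {0<..} v * (v powr (- (r / \<alpha>)) * (\<theta> / (\<theta> + v)\<^sup>2))) \<partial>lborel)"
    by (rule nn_integral_powr_substitution[OF _ _ \<alpha>(1)]) (use \<theta> in auto)
  also have "\<dots> = ennreal (\<theta> powr (- (r / \<alpha>)) * Gamma (1 - r / \<alpha>) * Gamma (1 + r / \<alpha>))"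
    using nn_integral_powr_cauchy_kernel[OF \<theta> ra] by simp
  finally have eq: "ennreal (Gamma (1 - r)) * (\<integral>\<^sup>+x. ennreal (S x powr r) \<partial>M) =
    ennreal (\<theta> powr (- (r / \<alpha>)) * Gamma (1 - r / \<alpha>) * Gamma (1 + r / \<alpha>))" (is "_ * ?I = ennreal ?R") .
  have Gp: "Gamma (1 - r) > 0" "Gamma (1 - r / \<alpha>) > 0" "Gamma (1 + r / \<alpha>) > 0"
    using r1 ra by (auto intro!: Gamma_real_pos simp: abs_less_iff simp del: abs_divide abs_minus)
  have "?I = ennreal (1 / Gamma (1 - r)) * ennreal (Gamma (1 - r)) * ?I"
    using Gp by (simp flip: ennreal_mult)
  also have "\<dots> = ennreal (1 / Gamma (1 - r)) * ennreal ?R"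
    unfolding mult.assoc eq ..
  also have "\<dots> = ennreal (\<theta> powr (- (r / \<alpha>)) * Gamma (1 + r / \<alpha>) * Gamma (1 - r / \<alpha>) / Gamma (1 - r))"
    using Gp by (simp add: mult_ac flip: ennreal_mult)
  finally show ?thesis
    by (intro has_bochner_integral_nn_integral) (use Gp in auto)
qed

end

section \<open>Moments of the logarithm of the waiting time\<close>
lemma power_series_coeff_chain:
  fixes c :: "nat \<Rightarrow> real" and g :: "nat \<Rightarrow> real \<Rightarrow> real"
  assumes d: "d > 0"
    and sums: "\<And>h. \<bar>h\<bar> < d \<Longrightarrow> (\<lambda>k. c k * h ^ k) sums g 0 h"
    and deriv: "\<And>i h. i < n \<Longrightarrow> \<bar>h\<bar> < d \<Longrightarrow> (g i has_real_derivative g (Suc i) h) (at h)"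
    and i: "i \<le> n"
  shows "fact i * c i = g i 0"
proof -
  have sm: "summable (\<lambda>k. (diffs ^^ i) c k * h ^ k)" if "\<bar>h\<bar> < d" for h i
    using that
  proof (induction i arbitrary: h)
    case 0
    thus ?case using sums by (auto simp: sums_iff)
  next
    case (Suc i)
    show ?case
      using termdiff_converges[of h d "(diffs ^^ i) c"] Suc by auto
  qed
  have eq: "\<forall>h. \<bar>h\<bar> < d \<longrightarrow> (\<Sum>k. (diffs ^^ i) c k * h ^ k) = g i h"
    using i
  proof (induction i)
    case 0
    thus ?case using sums by (auto simp: sums_iff)
  next
    case (Suc i)
    show ?case
    proof (intro allI impI)
      fix h :: real assume h: "\<bar>h\<bar> < d"
      have 1: "((\<lambda>h. \<Sum>k. (diffs ^^ i) c k * h ^ k) has_real_derivative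
          (\<Sum>k. diffs ((diffs ^^ i) c) k * h ^ k)) (at h)"
        by (rule termdiffs_strong'[where K = d]) (use sm h in auto)
      have "\<forall>\<^sub>F x in nhds h. x \<in> ball 0 d"
        using h by (intro eventually_nhds_in_open) auto
      hence "\<forall>\<^sub>F x in nhds h. (\<Sum>k. (diffs ^^ i) c k * x ^ k) = g i x"
        by eventually_elim (use Suc in auto)
      hence "(g i has_real_derivative (\<Sum>k. diffs ((diffs ^^ i) c) k * h ^ k)) (at h)"
        using 1 by (subst (asm) DERIV_cong_ev) auto
      thus "(\<Sum>k. (diffs ^^ Suc i) c k * h ^ k) = g (Suc i) h"
        using DERIV_unique deriv[of i h] h Suc.prems by auto
    qed
  qed
  have "(diffs ^^ i) c 0 = fact i * c i"
  proof -
    have "(diffs ^^ i) c k = pochhammer (of_nat (Suc k)) i * c (k + i)" for k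
      by (induction i arbitrary: k) (simp_all add: diffs_def pochhammer_rec algebra_simps)
    thus ?thesis by (simp add: pochhammer_fact)
  qed
  moreover have "(diffs ^^ i) c 0 = g i 0"
    using spec[OF eq, of 0] d by simp
  ultimately show ?thesis by simp
qed

text \<open>
  If \<open>g\<close> is a moment generating function and \<open>k0\<close> the derivative of its logarithm, then \<open>fact i * c i\<close> is
  the \<open>i\<close>-th moment and the derivatives of \<open>k0\<close> at \<open>0\<close> are the cumulants; these are the usual relations
  between moments and cumulants up to order four, for mean zero.
\<close>
lemma power_series_coeff_of_log_derivative:
  fixes c :: "nat \<Rightarrow> real" and g k0 k1 k2 k3 :: "real \<Rightarrow> real"
  assumes d: "d > 0"
    and sums: "\<And>h. \<bar>h\<bar> < d \<Longrightarrow> (\<lambda>k. c k * h ^ k) sums g h"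
    and g: "\<And>h. \<bar>h\<bar> < d \<Longrightarrow> (g has_real_derivative g h * k0 h) (at h)"
    and k0: "\<And>h. \<bar>h\<bar> < d \<Longrightarrow> (k0 has_real_derivative k1 h) (at h)"
    and k1: "\<And>h. \<bar>h\<bar> < d \<Longrightarrow> (k1 has_real_derivative k2 h) (at h)"
    and k2: "\<And>h. \<bar>h\<bar> < d \<Longrightarrow> (k2 has_real_derivative k3 h) (at h)"
    and at0: "g 0 = 1" "k0 0 = 0"
  shows "c 0 = 1" "c 1 = 0" "2 * c 2 = k1 0" "6 * c 3 = k2 0" "24 * c 4 = k3 0 + 3 * (k1 0)\<^sup>2"
proof -
  define G :: "nat \<Rightarrow> real \<Rightarrow> real" where "G = (\<lambda>i.
    if i = 0 then g else if i = 1 then (\<lambda>h. g h * k0 h)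
    else if i = 2 then (\<lambda>h. g h * ((k0 h)\<^sup>2 + k1 h))
    else if i = 3 then (\<lambda>h. g h * (k0 h ^ 3 + 3 * k0 h * k1 h + k2 h))
    else (\<lambda>h. g h * (k0 h ^ 4 + 6 * (k0 h)\<^sup>2 * k1 h + 3 * (k1 h)\<^sup>2 + 4 * k0 h * k2 h + k3 h)))"
  have "(G i has_real_derivative G (Suc i) h) (at h)" if i: "i < 4" and h: "\<bar>h\<bar> < d" for i h
  proof -
    note [derivative_intros] = g[OF h] k0[OF h] k1[OF h] k2[OF h]
    consider "i = 0" | "i = 1" | "i = 2" | "i = 3" using i by linarith
    thus ?thesis
    proof cases
      case 1
      thus ?thesis using g[OF h] by (simp add: G_def)
    next
      case 2
      thus ?thesis unfolding G_def
        by (auto intro!: derivative_eq_intros simp: algebra_simps power2_eq_square)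
    next
      case 3
      thus ?thesis unfolding G_def
        by (auto intro!: derivative_eq_intros simp: algebra_simps power2_eq_square power3_eq_cube)
    next
      case 4
      thus ?thesis unfolding G_def
        by (auto intro!: derivative_eq_intros simp: algebra_simps power2_eq_square power3_eq_cube power4_eq_xxxx)
    qed
  qed
  note chain = power_series_coeff_chain[where g = G and c = c and n = 4, OF d _ this]
  have coeff: "fact i * c i = G i 0" if "i \<le> 4" for i
    by (rule chain) (use sums that in \<open>auto simp: G_def\<close>)
  show "c 0 = 1" "c 1 = 0" "2 * c 2 = k1 0" "6 * c 3 = k2 0" "24 * c 4 = k3 0 + 3 * (k1 0)\<^sup>2"
    using coeff[of 0] coeff[of 1] coeff[of 2] coeff[of 3] coeff[of 4] at0
    by (simp_all add: G_def fact_numeral)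
qed

lemma Polygamma_2_one: "Polygamma 2 (1::real) = - 2 * zeta 3"
proof -
  have "(\<lambda>k. inverse ((1 + real k) ^ Suc 2)) sums ((-1) ^ Suc 2 * Polygamma 2 1 / fact 2)"
    by (rule Polygamma_LIMSEQ) auto
  moreover have "inverse ((1 + real k) ^ Suc 2) = 1 / real (Suc k) powr 3" for k
    by (simp add: divide_inverse powr_numeral add_ac)
  ultimately have "zeta 3 = (-1) ^ Suc 2 * Polygamma 2 1 / fact 2"
    unfolding zeta_def by (simp add: sums_iff)
  thus ?thesis by (simp add: fact_numeral)
qed

text \<open>
  In other words \<open>\<zeta>(2) = \<pi>\<^sup>2 / 6\<close> and \<open>\<zeta>(4) = \<pi>\<^sup>4 / 90\<close>. By the reflection formula,
  \<open>1 / (\<Gamma>(1 + h) \<Gamma>(1 - h)) = sin (\<pi> h) / (\<pi> h)\<close>; the values follow by comparing the coefficients of the sine series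
  with those obtained from the logarithmic derivative of the left-hand side.
\<close>
lemma Polygamma_1_3_one:
  "Polygamma 1 (1::real) = pi\<^sup>2 / 6" "Polygamma 3 (1::real) = pi ^ 4 / 15"
proof -
  define g where "g h = rGamma (1 + h) * rGamma (1 - h)" for h :: real
  define k where "k i h = (- Polygamma i (1 + h) + (-1) ^ i * Polygamma i (1 - h))" for i :: nat and h :: real
  define s where "s n = sin_coeff (Suc n) * pi ^ n" for n
  have nz: "1 + h \<notin> \<int>\<^sub>\<le>\<^sub>0" "1 - h \<notin> \<int>\<^sub>\<le>\<^sub>0" if "\<bar>h\<bar> < 1" for h :: real
    using that by (auto dest!: nonpos_Ints_nonpos)
  have gk: "(g has_real_derivative g h * k 0 h) (at h)" if h: "\<bar>h\<bar> < 1" for h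
    unfolding g_def k_def using nz[OF h]
    by (auto intro!: derivative_eq_intros has_field_derivative_rGamma_no_nonpos_int[THEN DERIV_chain2] simp: algebra_simps)
  have kk: "(k i has_real_derivative k (Suc i) h) (at h)" if h: "\<bar>h\<bar> < 1" for i h
    unfolding k_def using nz[OF h] by (auto intro!: derivative_eq_intros simp: algebra_simps)
  have refl: "g h * (pi * h) = sin (pi * h)" for h
  proof -
    have "complex_of_real (rGamma h * rGamma (1 - h)) = complex_of_real (sin (pi * h) / pi)"
      using rGamma_reflection_complex[of "complex_of_real h"]
        rGamma_complex_of_real[of h] rGamma_complex_of_real[of "1 - h"] sin_of_real[of "pi * h", where ?'a = complex]
      by simp
    hence "rGamma h * rGamma (1 - h) = sin (pi * h) / pi" by (simp only: of_real_eq_iff)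
    moreover have "rGamma h = h * rGamma (1 + h)" using rGamma_plus1[of h] by (simp add: add.commute)
    ultimately show ?thesis by (simp add: g_def field_simps)
  qed
  have "(\<lambda>n. s n * h ^ n) sums g h" if h: "\<bar>h\<bar> < 1" for h
  proof (cases "h = 0")
    case True
    have "(\<lambda>n. s n * 0 ^ n) sums (s 0)" using powser_sums_zero[of s] by simp
    thus ?thesis using True by (simp add: s_def g_def sin_coeff_def)
  next
    case False
    have "(\<lambda>n. sin_coeff n * (pi * h) ^ n) sums sin (pi * h)"
      using sin_converges[of "pi * h"] by simp
    hence "(\<lambda>n. sin_coeff (Suc n) * (pi * h) ^ Suc n) sums sin (pi * h)"
      by (subst sums_Suc_iff) (simp add: sin_coeff_def)
    hence "(\<lambda>n. sin_coeff (Suc n) * (pi * h) ^ Suc n / (pi * h)) sums (sin (pi * h) / (pi * h))"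
      by (rule sums_divide)
    also have "(\<lambda>n. sin_coeff (Suc n) * (pi * h) ^ Suc n / (pi * h)) = (\<lambda>n. s n * h ^ n)"
      using False by (auto simp: s_def power_mult_distrib field_simps)
    also have "sin (pi * h) / (pi * h) = g h" using refl[of h] False by (simp add: field_simps)
    finally show ?thesis .
  qed
  note coeffs = power_series_coeff_of_log_derivative[OF zero_less_one this gk kk kk kk]
  have at0: "g 0 = 1" "k 0 0 = 0" by (simp_all add: g_def k_def)
  have "2 * s 2 = - pi\<^sup>2 / 3" "24 * s 4 = pi ^ 4 / 5"
    by (simp_all add: s_def sin_coeff_def fact_numeral)
  moreover have "k (Suc 0) 0 = - 2 * Polygamma 1 1" "k (Suc (Suc (Suc 0))) 0 = - 2 * Polygamma 3 1"
    by (simp_all add: k_def eval_nat_numeral)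
  ultimately have c2: "- 2 * Polygamma 1 (1::real) = - pi\<^sup>2 / 3"
    and c4: "pi ^ 4 / 5 = - 2 * Polygamma 3 1 + 3 * (- 2 * Polygamma 1 (1::real))\<^sup>2"
    using coeffs(3,5)[OF _ _ _ _ _ at0] by simp_all
  show p1: "Polygamma 1 (1::real) = pi\<^sup>2 / 6" using c2 by simp
  show "Polygamma 3 (1::real) = pi ^ 4 / 15"
    using c4 unfolding p1 by (simp add: power_divide flip: power_mult)
qed

context prob_space
begin

text \<open>
  The shift by \<open>ln \<theta> / \<alpha> + euler_mascheroni\<close> cancels the factor \<open>\<theta> powr (- (h / \<alpha>))\<close> of the moment generating
  function and makes the mean zero.
\<close>
lemma log_moments_of_laplace:
  fixes S :: "'a \<Rightarrow> real"
  assumes S [measurable]: "S \<in> borel_measurable M" and pos: "AE x in M. S x > 0"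
    and \<alpha>: "0 < \<alpha>" "\<alpha> \<le> 1" and \<theta>: "\<theta> > 0"
    and L: "\<And>u. u > 0 \<Longrightarrow> expectation (\<lambda>x. exp (- (u * S x))) = \<theta> / (\<theta> + u powr \<alpha>)"
  defines "Y \<equiv> \<lambda>x. ln (S x) + ln \<theta> / \<alpha> + euler_mascheroni"
  shows "\<And>k. integrable M (\<lambda>x. Y x ^ k)"
    and "expectation Y = 0"
    and "expectation (\<lambda>x. (Y x)\<^sup>2) = pi\<^sup>2 / (3 * \<alpha>\<^sup>2) - pi\<^sup>2 / 6"
    and "expectation (\<lambda>x. Y x ^ 3) = - 2 * zeta 3"
    and "expectation (\<lambda>x. Y x ^ 4) = pi ^ 4 * (2 / \<alpha> ^ 4 - 1) / 15 + 3 * (pi\<^sup>2 / (3 * \<alpha>\<^sup>2) - pi\<^sup>2 / 6)\<^sup>2"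
proof -
  have [measurable]: "Y \<in> borel_measurable M" unfolding Y_def by measurable
  define g where "g h = exp (euler_mascheroni * h) * Gamma (1 + h / \<alpha>) * Gamma (1 - h / \<alpha>) * rGamma (1 - h)" for h :: real
  define k0 where "k0 h = euler_mascheroni + Polygamma 0 (1 + h / \<alpha>) / \<alpha> - Polygamma 0 (1 - h / \<alpha>) / \<alpha> + Polygamma 0 (1 - h)" for h :: real
  define k where "k i h = Polygamma i (1 + h / \<alpha>) / \<alpha> ^ Suc i + (-1) ^ Suc i * Polygamma i (1 - h / \<alpha>) / \<alpha> ^ Suc i
    + (-1) ^ i * Polygamma i (1 - h)" for i :: nat and h :: real
  have mgf: "has_bochner_integral M (\<lambda>x. exp (h * Y x)) (g h)" if h: "\<bar>h\<bar> < \<alpha>" for h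
  proof -
    have G: "Gamma (1 - h) > 0" using h \<alpha> by (intro Gamma_real_pos) auto
    have "has_bochner_integral M (\<lambda>x. exp (h * (ln \<theta> / \<alpha> + euler_mascheroni)) * S x powr h)
        (exp (h * (ln \<theta> / \<alpha> + euler_mascheroni)) *
         (\<theta> powr (- (h / \<alpha>)) * Gamma (1 + h / \<alpha>) * Gamma (1 - h / \<alpha>) / Gamma (1 - h)))"
      by (intro has_bochner_integral_mult_right has_bochner_integral_powr_of_laplace[OF S pos \<alpha> \<theta> L h]) auto
    also have "exp (h * (ln \<theta> / \<alpha> + euler_mascheroni)) *
         (\<theta> powr (- (h / \<alpha>)) * Gamma (1 + h / \<alpha>) * Gamma (1 - h / \<alpha>) / Gamma (1 - h)) = g h"
    proof -
      have "exp (h * (ln \<theta> / \<alpha> + euler_mascheroni)) * \<theta> powr (- (h / \<alpha>)) = exp (euler_mascheroni * h)"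
        using \<theta> by (simp add: powr_def algebra_simps flip: exp_add)
      thus ?thesis unfolding g_def by (simp add: Gamma_def divide_inverse)
    qed
    finally have *: "has_bochner_integral M (\<lambda>x. exp (h * (ln \<theta> / \<alpha> + euler_mascheroni)) * S x powr h) (g h)" .
    show ?thesis
      by (rule has_bochner_integralI_AE[OF *])
         (measurable, use pos in \<open>auto elim!: eventually_mono simp: Y_def powr_def algebra_simps simp flip: exp_add\<close>)
  qed
  define r where "r = \<alpha> / 2"
  have r: "r > 0" "r < \<alpha>" using \<alpha> by (auto simp: r_def)
  have int: "integrable M (\<lambda>x. 1 * exp (r * \<bar>Y x\<bar>))"
  proof (rule Bochner_Integration.integrable_bound)
    show "integrable M (\<lambda>x. exp (r * Y x) + exp ((- r) * Y x))"
      using mgf[of r] mgf[of "- r"] r by (auto simp: has_bochner_integral_iff)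
    show "AE x in M. norm (1 * exp (r * \<bar>Y x\<bar>)) \<le> norm (exp (r * Y x) + exp ((- r) * Y x))"
    proof (rule AE_I2)
      fix x
      have "1 * exp (r * \<bar>Y x\<bar>) \<le> exp (r * Y x) + exp ((- r) * Y x)"
        by (cases "Y x \<ge> 0") auto
      thus "norm (1 * exp (r * \<bar>Y x\<bar>)) \<le> norm (exp (r * Y x) + exp ((- r) * Y x))"
        by (simp add: order.trans[OF _ abs_ge_self])
    qed
  qed measurable
  have intk: "integrable M (\<lambda>x. Y x ^ k)" for k
    using sums_integral_exp(1)[OF _ _ _ int r(1), of k] by simp
  show "\<And>k. integrable M (\<lambda>x. Y x ^ k)" by (rule intk)
  define c where "c k = expectation (\<lambda>x. Y x ^ k) / fact k" for k
  have c: "(\<lambda>k. c k * h ^ k) sums g h" if "\<bar>h\<bar> < r" for h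
    using sums_integral_exp(2)[OF _ _ _ int r(1), of h] that mgf[of h] r
    by (simp add: c_def has_bochner_integral_iff)
  have nz: "1 + h / \<alpha> \<notin> \<int>\<^sub>\<le>\<^sub>0" "1 - h / \<alpha> \<notin> \<int>\<^sub>\<le>\<^sub>0" "1 - h \<notin> \<int>\<^sub>\<le>\<^sub>0" if h: "\<bar>h\<bar> < r" for h :: real
  proof -
    have "\<bar>h / \<alpha>\<bar> < 1" "\<bar>h\<bar> < 1" using h r \<alpha> by auto
    thus "1 + h / \<alpha> \<notin> \<int>\<^sub>\<le>\<^sub>0" "1 - h / \<alpha> \<notin> \<int>\<^sub>\<le>\<^sub>0" "1 - h \<notin> \<int>\<^sub>\<le>\<^sub>0"
      by (auto dest!: nonpos_Ints_nonpos simp: abs_less_iff simp del: abs_divide)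
  qed
  have dg: "(g has_real_derivative g h * k0 h) (at h)" if h: "\<bar>h\<bar> < r" for h
    unfolding g_def k0_def using nz[OF h] \<alpha>
    by (auto intro!: derivative_eq_intros has_field_derivative_rGamma_no_nonpos_int[THEN DERIV_chain2] simp: algebra_simps)
  have dk0: "(k0 has_real_derivative k 1 h) (at h)" if h: "\<bar>h\<bar> < r" for h
    unfolding k0_def k_def using nz[OF h] \<alpha>
    by (auto intro!: derivative_eq_intros simp: field_simps power2_eq_square)
  have dk: "(k i has_real_derivative k (Suc i) h) (at h)" if h: "\<bar>h\<bar> < r" for i h
    unfolding k_def using nz[OF h] \<alpha>
    by (auto intro!: derivative_eq_intros simp: field_simps power2_eq_square)
  have at0: "g 0 = 1" "k0 0 = 0" by (simp_all add: g_def k0_def)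
  note coeffs = power_series_coeff_of_log_derivative[OF r(1) c dg dk0 dk dk at0]
  have E: "expectation (\<lambda>x. Y x ^ i) = fact i * c i" for i by (simp add: c_def)
  show "expectation Y = 0" using E[of 1] coeffs(2) by simp
  show "expectation (\<lambda>x. Y x ^ 3) = - 2 * zeta 3"
    using E[of 3] coeffs(4) Polygamma_2_one by (simp add: k_def fact_numeral numeral_2_eq_2)
  have "k 1 0 = 2 * Polygamma 1 1 / \<alpha>\<^sup>2 - Polygamma 1 1"
    by (simp add: k_def power2_eq_square)
  hence k1: "k 1 0 = pi\<^sup>2 / (3 * \<alpha>\<^sup>2) - pi\<^sup>2 / 6"
    unfolding Polygamma_1_3_one(1) by simp
  show "expectation (\<lambda>x. (Y x)\<^sup>2) = pi\<^sup>2 / (3 * \<alpha>\<^sup>2) - pi\<^sup>2 / 6"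
    using E[of 2] coeffs(3) unfolding k1 by simp
  have "k (Suc (Suc 1)) 0 = 2 * Polygamma 3 1 / \<alpha> ^ 4 - Polygamma 3 1"
    by (simp add: k_def eval_nat_numeral)
  hence k3: "k (Suc (Suc 1)) 0 = pi ^ 4 * (2 / \<alpha> ^ 4 - 1) / 15"
    unfolding Polygamma_1_3_one(2) by (simp add: algebra_simps)
  show "expectation (\<lambda>x. Y x ^ 4) = pi ^ 4 * (2 / \<alpha> ^ 4 - 1) / 15 + 3 * (pi\<^sup>2 / (3 * \<alpha>\<^sup>2) - pi\<^sup>2 / 6)\<^sup>2"
    using E[of 4] coeffs(5) unfolding k1 k3 by (simp add: fact_numeral)
qed

end

section \<open>Independent sequences and sample means\<close>
context prob_space
begin

lemma expectation_sum_sq_orthogonal: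
  fixes W :: "nat \<Rightarrow> 'a \<Rightarrow> real"
  assumes [measurable]: "\<And>i. W i \<in> borel_measurable M"
    and int: "\<And>i. integrable M (\<lambda>x. (W i x)\<^sup>2)"
    and orth: "\<And>i j. i \<noteq> j \<Longrightarrow> expectation (\<lambda>x. W i x * W j x) = 0"
    and var: "\<And>i. expectation (\<lambda>x. (W i x)\<^sup>2) = s"
  shows "integrable M (\<lambda>x. (\<Sum>i<n. W i x)\<^sup>2)"
    and "expectation (\<lambda>x. (\<Sum>i<n. W i x)\<^sup>2) = real n * s"
proof -
  have intp: "integrable M (\<lambda>x. W i x * W j x)" for i j
  proof (rule Bochner_Integration.integrable_bound)
    show "integrable M (\<lambda>x. (W i x)\<^sup>2 + (W j x)\<^sup>2)" using int by simp
    show "AE x in M. norm (W i x * W j x) \<le> norm ((W i x)\<^sup>2 + (W j x)\<^sup>2)"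
    proof (rule AE_I2)
      fix x
      have "0 \<le> (\<bar>W i x\<bar> - \<bar>W j x\<bar>)\<^sup>2" by simp
      hence "2 * (\<bar>W i x\<bar> * \<bar>W j x\<bar>) \<le> (W i x)\<^sup>2 + (W j x)\<^sup>2"
        by (simp add: power2_diff)
      moreover have "0 \<le> \<bar>W i x\<bar> * \<bar>W j x\<bar>" by simp
      ultimately show "norm (W i x * W j x) \<le> norm ((W i x)\<^sup>2 + (W j x)\<^sup>2)"
        unfolding real_norm_def abs_mult by linarith
    qed
  qed measurable
  have sq: "(\<Sum>i<n. W i x)\<^sup>2 = (\<Sum>i<n. \<Sum>j<n. W i x * W j x)" for x
    by (simp add: power2_eq_square sum_product)
  show "integrable M (\<lambda>x. (\<Sum>i<n. W i x)\<^sup>2)"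
    unfolding sq by (intro Bochner_Integration.integrable_sum intp)
  have "expectation (\<lambda>x. (\<Sum>i<n. W i x)\<^sup>2) = (\<Sum>i<n. \<Sum>j<n. expectation (\<lambda>x. W i x * W j x))"
    unfolding sq using intp by (simp add: Bochner_Integration.integral_sum)
  also have "\<dots> = (\<Sum>i<n. \<Sum>j<n. if i = j then s else 0)"
    using var orth by (intro sum.cong refl) (auto simp: power2_eq_square)
  also have "\<dots> = real n * s" by simp
  finally show "expectation (\<lambda>x. (\<Sum>i<n. W i x)\<^sup>2) = real n * s" .
qed

text \<open>
  Two independent sequences, each with independent members, form a sequence of independent pairs. The
  events \<open>X j \<in> A \<and> Y j \<in> B\<close> generate the \<open>j\<close>-th \<open>\<sigma>\<close>-algebra and are stable under intersection, so it is enough to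
  check the product formula on them.
\<close>
lemma indep_vars_of_independent_sequences:
  assumes X: "indep_vars (\<lambda>_. N) X UNIV" and Y: "indep_vars (\<lambda>_. N') Y UNIV"
    and XY: "indep_rv_pair M (Pi\<^sub>M UNIV (\<lambda>_. N)) (\<lambda>\<omega> j. X j \<omega>) (Pi\<^sub>M UNIV (\<lambda>_. N')) (\<lambda>\<omega> j. Y j \<omega>)"
  shows "indep_vars (\<lambda>_. N \<Otimes>\<^sub>M N') (\<lambda>j \<omega>. (X j \<omega>, Y j \<omega>)) UNIV"
    and "A \<in> sets N \<Longrightarrow> B \<in> sets N' \<Longrightarrow>
      prob (X j -` A \<inter> Y j -` B \<inter> space M) = prob (X j -` A \<inter> space M) * prob (Y j -` B \<inter> space M)"
proof -
  have [measurable]: "X j \<in> measurable M N" "Y j \<in> measurable M N'" for j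
    using X Y by (auto simp: indep_vars_def)
  have ind: "indep_set {(\<lambda>\<omega> j. X j \<omega>) -` A \<inter> space M |A. A \<in> sets (Pi\<^sub>M UNIV (\<lambda>_. N))}
       {(\<lambda>\<omega> j. Y j \<omega>) -` B \<inter> space M |B. B \<in> sets (Pi\<^sub>M UNIV (\<lambda>_. N'))}"
    using XY by (auto simp: indep_rv_pair_def)
  define E where "E j = {X j -` A \<inter> Y j -` B \<inter> space M |A B. A \<in> sets N \<and> B \<in> sets N'}" for j
  have prod: "prob (\<Inter>j\<in>J. X j -` a j \<inter> Y j -` b j \<inter> space M) =
      (\<Prod>j\<in>J. prob (X j -` a j \<inter> space M) * prob (Y j -` b j \<inter> space M))"
    if J: "finite J" "J \<noteq> {}" and ab: "\<And>j. j \<in> J \<Longrightarrow> a j \<in> sets N" "\<And>j. j \<in> J \<Longrightarrow> b j \<in> sets N'"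
    for J :: "'b set" and a b
  proof -
    have emb: "\<exists>A \<in> sets (Pi\<^sub>M UNIV (\<lambda>_. N'')). (\<Inter>j\<in>J. Z j -` c j \<inter> space M) = (\<lambda>\<omega> j. Z j \<omega>) -` A \<inter> space M"
      if Z: "\<And>j. Z j \<in> measurable M N''" and c: "\<And>j. j \<in> J \<Longrightarrow> c j \<in> sets N''"
      for Z :: "'b \<Rightarrow> 'a \<Rightarrow> 'e" and c N''
    proof
      show "prod_emb UNIV (\<lambda>_. N'') J (Pi\<^sub>E J c) \<in> sets (Pi\<^sub>M UNIV (\<lambda>_. N''))"
        using J c by (intro sets_PiM_I) auto
      show "(\<Inter>j\<in>J. Z j -` c j \<inter> space M) = (\<lambda>\<omega> j. Z j \<omega>) -` prod_emb UNIV (\<lambda>_. N'') J (Pi\<^sub>E J c) \<inter> space M"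
        using J measurable_space[OF Z] by (auto simp: prod_emb_def space_PiM PiE_def Pi_def)
    qed
    obtain A where A: "A \<in> sets (Pi\<^sub>M UNIV (\<lambda>_. N))"
        "(\<Inter>j\<in>J. X j -` a j \<inter> space M) = (\<lambda>\<omega> j. X j \<omega>) -` A \<inter> space M"
      using emb[of X N a] ab(1) by auto
    obtain B where B: "B \<in> sets (Pi\<^sub>M UNIV (\<lambda>_. N'))"
        "(\<Inter>j\<in>J. Y j -` b j \<inter> space M) = (\<lambda>\<omega> j. Y j \<omega>) -` B \<inter> space M"
      using emb[of Y N' b] ab(2) by auto
    have "(\<Inter>j\<in>J. X j -` a j \<inter> Y j -` b j \<inter> space M) =
        (\<Inter>j\<in>J. X j -` a j \<inter> space M) \<inter> (\<Inter>j\<in>J. Y j -` b j \<inter> space M)" using J by auto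
    also have "prob \<dots> = prob (\<Inter>j\<in>J. X j -` a j \<inter> space M) * prob (\<Inter>j\<in>J. Y j -` b j \<inter> space M)"
      by (rule indep_setD[OF ind]) (use A B in auto)
    also have "\<dots> = (\<Prod>j\<in>J. prob (X j -` a j \<inter> space M)) * (\<Prod>j\<in>J. prob (Y j -` b j \<inter> space M))"
      using indep_varsD[OF X J(2,1), of a] indep_varsD[OF Y J(2,1), of b] ab by simp
    finally show ?thesis by (simp add: prod.distrib)
  qed
  show pair: "prob (X j -` A \<inter> Y j -` B \<inter> space M) = prob (X j -` A \<inter> space M) * prob (Y j -` B \<inter> space M)"
    if "A \<in> sets N" "B \<in> sets N'" for j A B
    using prod[of "{j}" "\<lambda>_. A" "\<lambda>_. B"] that by simp
  have "indep_sets E UNIV"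
  proof (rule indep_setsI)
    show "E i \<subseteq> events" for i unfolding E_def by auto
    fix F J assume J: "J \<noteq> {}" "finite J" and F: "\<forall>j\<in>J. F j \<in> E j"
    obtain a b where ab: "\<And>j. j \<in> J \<Longrightarrow> a j \<in> sets N" "\<And>j. j \<in> J \<Longrightarrow> b j \<in> sets N'"
      "\<And>j. j \<in> J \<Longrightarrow> F j = X j -` a j \<inter> Y j -` b j \<inter> space M"
      using F unfolding E_def mem_Collect_eq by metis
    have "prob (\<Inter>j\<in>J. F j) = prob (\<Inter>j\<in>J. X j -` a j \<inter> Y j -` b j \<inter> space M)"
      using ab(3) by simp
    also have "\<dots> = (\<Prod>j\<in>J. prob (X j -` a j \<inter> space M) * prob (Y j -` b j \<inter> space M))"
      by (rule prod[OF J(2,1) ab(1,2)])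
    also have "\<dots> = (\<Prod>j\<in>J. prob (F j))"
      using ab pair by (intro prod.cong) auto
    finally show "prob (\<Inter>j\<in>J. F j) = (\<Prod>j\<in>J. prob (F j))" .
  qed
  moreover have "Int_stable (E j)" for j
  proof (rule Int_stableI)
    fix a b assume "a \<in> E j" "b \<in> E j"
    then obtain A B A' B' where "A \<in> sets N" "A' \<in> sets N" "B \<in> sets N'" "B' \<in> sets N'"
      "a = X j -` A \<inter> Y j -` B \<inter> space M" "b = X j -` A' \<inter> Y j -` B' \<inter> space M"
      unfolding E_def by blast
    hence "a \<inter> b = X j -` (A \<inter> A') \<inter> Y j -` (B \<inter> B') \<inter> space M" "A \<inter> A' \<in> sets N" "B \<inter> B' \<in> sets N'"
      by auto
    thus "a \<inter> b \<in> E j" unfolding E_def by blast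
  qed
  ultimately have sig: "indep_sets (\<lambda>j. sigma_sets (space M) (E j)) UNIV"
    by (rule indep_sets_sigma)
  have sub: "{(\<lambda>\<omega>. (X j \<omega>, Y j \<omega>)) -` C \<inter> space M |C. C \<in> sets (N \<Otimes>\<^sub>M N')} \<subseteq> sigma_sets (space M) (E j)" for j
  proof -
    have rect: "X j -` a \<inter> Y j -` b \<inter> space M = (\<lambda>\<omega>. (X j \<omega>, Y j \<omega>)) -` (a \<times> b) \<inter> space M" for a b
      by auto
    have "sigma_sets (space M) (E j) =
        sigma_sets (space M) {(\<lambda>\<omega>. (X j \<omega>, Y j \<omega>)) -` C \<inter> space M |C. C \<in> {a \<times> b |a b. a \<in> sets N \<and> b \<in> sets N'}}"
      unfolding E_def rect by (intro arg_cong[where f = "sigma_sets (space M)"]) blast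
    also have "\<dots> = {(\<lambda>\<omega>. (X j \<omega>, Y j \<omega>)) -` C \<inter> space M |C. C \<in> sigma_sets (space N \<times> space N') {a \<times> b |a b. a \<in> sets N \<and> b \<in> sets N'}}"
      by (rule sigma_sets_vimage_commute[symmetric]) (use measurable_space[of "X j" M N] measurable_space[of "Y j" M N'] in auto)
    also have "sigma_sets (space N \<times> space N') {a \<times> b |a b. a \<in> sets N \<and> b \<in> sets N'} = sets (N \<Otimes>\<^sub>M N')"
      by (simp add: sets_pair_measure)
    finally show ?thesis by simp
  qed
  show "indep_vars (\<lambda>_. N \<Otimes>\<^sub>M N') (\<lambda>j \<omega>. (X j \<omega>, Y j \<omega>)) UNIV"
    unfolding indep_vars_def2
  proof (intro conjI ballI)
    show "indep_sets (\<lambda>j. {(\<lambda>\<omega>. (X j \<omega>, Y j \<omega>)) -` A \<inter> space M |A. A \<in> sets (N \<Otimes>\<^sub>M N')}) UNIV"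
      by (rule indep_sets_mono_sets[OF sig sub])
  qed measurable
qed

lemma indep_varI_rectangles:
  assumes [measurable]: "X \<in> measurable M N" "Y \<in> measurable M N'"
    and rect: "\<And>A B. A \<in> sets N \<Longrightarrow> B \<in> sets N' \<Longrightarrow>
      prob (X -` A \<inter> Y -` B \<inter> space M) = prob (X -` A \<inter> space M) * prob (Y -` B \<inter> space M)"
  shows "indep_var N X N' Y"
  unfolding indep_var_eq
proof (intro conjI indep_set_sigma_sets)
  show "indep_set {X -` A \<inter> space M |A. A \<in> sets N} {Y -` A \<inter> space M |A. A \<in> sets N'}"
  proof (rule indep_setI)
    fix a b assume "a \<in> {X -` A \<inter> space M |A. A \<in> sets N}" "b \<in> {Y -` A \<inter> space M |A. A \<in> sets N'}"
    then obtain A B where "a = X -` A \<inter> space M" "b = Y -` B \<inter> space M" "A \<in> sets N" "B \<in> sets N'"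
      by blast
    moreover have "(X -` A \<inter> space M) \<inter> (Y -` B \<inter> space M) = X -` A \<inter> Y -` B \<inter> space M" for A B by auto
    ultimately show "prob (a \<inter> b) = prob a * prob b" using rect by simp
  qed auto
  have "Int_stable {Z -` A \<inter> space M |A. A \<in> sets N''}" for Z :: "'a \<Rightarrow> 'b" and N''
  proof (rule Int_stableI)
    fix a b assume "a \<in> {Z -` A \<inter> space M |A. A \<in> sets N''}" "b \<in> {Z -` A \<inter> space M |A. A \<in> sets N''}"
    then obtain A B where AB: "a = Z -` A \<inter> space M" "b = Z -` B \<inter> space M" "A \<in> sets N''" "B \<in> sets N''"
      by blast
    have "a \<inter> b = Z -` (A \<inter> B) \<inter> space M" using AB by auto
    thus "a \<inter> b \<in> {Z -` A \<inter> space M |A. A \<in> sets N''}" using AB sets.Int by blast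
  qed
  thus "Int_stable {X -` A \<inter> space M |A. A \<in> sets N}" "Int_stable {Y -` A \<inter> space M |A. A \<in> sets N'}"
    by auto
qed measurable

lemma sample_mean_sq:
  fixes W :: "nat \<Rightarrow> 'a \<Rightarrow> real"
  assumes indep: "indep_vars (\<lambda>_. borel) W UNIV"
    and mean: "\<And>i. expectation (W i) = 0"
    and int: "\<And>i. integrable M (\<lambda>x. (W i x)\<^sup>2)"
    and var: "\<And>i. expectation (\<lambda>x. (W i x)\<^sup>2) = s"
  shows "integrable M (\<lambda>x. ((\<Sum>i<n. W i x) / real n)\<^sup>2)"
    and "n > 0 \<Longrightarrow> expectation (\<lambda>x. ((\<Sum>i<n. W i x) / real n)\<^sup>2) = s / real n"
proof -
  have [measurable]: "W i \<in> borel_measurable M" for i using indep by (auto simp: indep_vars_def)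
  have intW: "integrable M (W i)" for i
    by (rule square_integrable_imp_integrable[OF _ int]) measurable
  have orth: "expectation (\<lambda>x. W i x * W j x) = 0" if "i \<noteq> j" for i j
    using indep_vars_lebesgue_integral[of "{i, j}" W] indep_vars_subset[OF indep, of "{i, j}"] intW mean that by simp
  note sq = expectation_sum_sq_orthogonal[where W = W and s = s and n = n, OF _ int orth var]
  show "integrable M (\<lambda>x. ((\<Sum>i<n. W i x) / real n)\<^sup>2)"
    using sq(1) by (simp add: power_divide)
  show "n > 0 \<Longrightarrow> expectation (\<lambda>x. ((\<Sum>i<n. W i x) / real n)\<^sup>2) = s / real n"
    using sq(2) by (simp add: power_divide power2_eq_square)
qed

end

section \<open>Weak convergence and the delta method\<close>
lemma char_distr:
  assumes [measurable]: "Z \<in> borel_measurable M"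
  shows "char (distr M borel Z) t = (CLINT x|M. iexp (t * Z x))"
  unfolding char_def by (rule integral_distr) measurable

context prob_space
begin

text \<open>
  Slutsky's theorem for sums: a perturbation that tends to \<open>0\<close> in probability does not change the weak
  limit. Characteristic functions of the two sequences differ by at most
  \<open>\<bar>t\<bar> * \<epsilon> + 2 * prob (\<bar>R n\<bar> \<ge> \<epsilon>)\<close>.
\<close>
lemma weak_conv_m_add_vanishing:
  fixes X R :: "nat \<Rightarrow> 'a \<Rightarrow> real"
  assumes X [measurable]: "\<And>n. X n \<in> borel_measurable M" and R [measurable]: "\<And>n. R n \<in> borel_measurable M"
    and \<mu>: "real_distribution \<mu>"
    and conv: "weak_conv_m (\<lambda>n. distr M borel (X n)) \<mu>"
    and van: "\<And>\<epsilon>. \<epsilon> > 0 \<Longrightarrow> (\<lambda>n. prob {x \<in> space M. \<bar>R n x\<bar> \<ge> \<epsilon>}) \<longlonglongrightarrow> 0"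
  shows "weak_conv_m (\<lambda>n. distr M borel (\<lambda>x. X n x + R n x)) \<mu>"
proof (rule levy_continuity)
  show "real_distribution (distr M borel (\<lambda>x. X n x + R n x))" for n
    by (rule real_distribution_distr) measurable
  show "real_distribution \<mu>" by fact
  fix t :: real
  have cX: "(\<lambda>n. char (distr M borel (X n)) t) \<longlonglongrightarrow> char \<mu> t"
    by (rule levy_continuity1[OF _ \<mu> conv]) (rule real_distribution_distr, measurable)
  have int: "integrable M (\<lambda>x. iexp (t * Z x))" if [measurable]: "Z \<in> borel_measurable M" for Z :: "'a \<Rightarrow> real"
    by (rule integrable_const_bound[where B = 1]) auto
  have bound: "cmod (char (distr M borel (\<lambda>x. X n x + R n x)) t - char (distr M borel (X n)) t)
      \<le> \<bar>t\<bar> * \<epsilon> + 2 * prob {x \<in> space M. \<bar>R n x\<bar> \<ge> \<epsilon>}" if \<epsilon>: "\<epsilon> > 0" for n \<epsilon>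
  proof -
    let ?A = "{x \<in> space M. \<bar>R n x\<bar> \<ge> \<epsilon>}"
    have intA: "integrable M (indicat_real ?A)"
      by (rule integrable_const_bound[where B = 1]) (auto simp: indicator_def)
    have "char (distr M borel (\<lambda>x. X n x + R n x)) t - char (distr M borel (X n)) t
        = (CLINT x|M. iexp (t * (X n x + R n x)) - iexp (t * X n x))"
      using int[of "\<lambda>x. X n x + R n x"] int[of "X n"] by (simp add: char_distr)
    also have "cmod \<dots> \<le> (\<integral>x. cmod (iexp (t * (X n x + R n x)) - iexp (t * X n x)) \<partial>M)"
      by (rule integral_norm_bound)
    also have "\<dots> \<le> (\<integral>x. \<bar>t\<bar> * \<epsilon> + 2 * indicator ?A x \<partial>M)"
    proof (rule integral_mono)
      show "integrable M (\<lambda>x. cmod (iexp (t * (X n x + R n x)) - iexp (t * X n x)))"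
        by (intro integrable_norm Bochner_Integration.integrable_diff int) measurable
      show "integrable M (\<lambda>x. \<bar>t\<bar> * \<epsilon> + 2 * indicator ?A x)"
        using intA by simp
      fix x assume x: "x \<in> space M"
      have "iexp (t * (X n x + R n x)) - iexp (t * X n x) = iexp (t * X n x) * (iexp (t * R n x) - 1)"
        by (simp add: algebra_simps flip: exp_add)
      hence eq: "cmod (iexp (t * (X n x + R n x)) - iexp (t * X n x)) = cmod (iexp (t * R n x) - 1)"
        by (simp add: norm_mult)
      show "cmod (iexp (t * (X n x + R n x)) - iexp (t * X n x)) \<le> \<bar>t\<bar> * \<epsilon> + 2 * indicator ?A x"
      proof (cases "x \<in> ?A")
        case True
        have "cmod (iexp (t * R n x) - 1) \<le> cmod (iexp (t * R n x)) + cmod 1" by (rule norm_triangle_ineq4)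
        thus ?thesis using True \<epsilon> unfolding eq by (simp add: add_increasing)
      next
        case False
        have "cmod (iexp (t * R n x) - 1) \<le> \<bar>t * R n x\<bar>"
          using iexp_approx1[of "t * R n x" 0] by simp
        also have "\<dots> \<le> \<bar>t\<bar> * \<epsilon>"
          using False x by (auto simp: abs_mult intro!: mult_left_mono)
        finally show ?thesis using False unfolding eq by simp
      qed
    qed
    also have "\<dots> = \<bar>t\<bar> * \<epsilon> + 2 * prob ?A"
      using intA by (simp add: prob_space)
    finally show ?thesis .
  qed
  have "(\<lambda>n. char (distr M borel (\<lambda>x. X n x + R n x)) t - char (distr M borel (X n)) t) \<longlonglongrightarrow> 0"
  proof (rule LIMSEQ_I)
    fix e :: real assume e: "e > 0"
    define \<epsilon> where "\<epsilon> = e / (2 * (\<bar>t\<bar> + 1))"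
    have \<epsilon>: "\<epsilon> > 0" unfolding \<epsilon>_def using e by (intro divide_pos_pos) auto
    have "(\<bar>t\<bar> + 1) * \<epsilon> = e / 2" unfolding \<epsilon>_def by (simp add: divide_simps)
    hence t\<epsilon>: "\<bar>t\<bar> * \<epsilon> < e / 2" using \<epsilon> by (simp add: algebra_simps)
    have "eventually (\<lambda>n. prob {x \<in> space M. \<bar>R n x\<bar> \<ge> \<epsilon>} < e / 4) sequentially"
      using van[OF \<epsilon>] e by (intro order_tendstoD(2)) auto
    then obtain N where N: "\<And>n. n \<ge> N \<Longrightarrow> prob {x \<in> space M. \<bar>R n x\<bar> \<ge> \<epsilon>} < e / 4"
      by (auto simp: eventually_sequentially)
    have "cmod (char (distr M borel (\<lambda>x. X n x + R n x)) t - char (distr M borel (X n)) t) < e" if "n \<ge> N" for n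
      using bound[OF \<epsilon>, of n] N[OF that] t\<epsilon> by linarith
    thus "\<exists>N. \<forall>n\<ge>N. norm (char (distr M borel (\<lambda>x. X n x + R n x)) t - char (distr M borel (X n)) t - 0) < e"
      by auto
  qed
  from tendsto_add[OF this cX] show "(\<lambda>n. char (distr M borel (\<lambda>x. X n x + R n x)) t) \<longlonglongrightarrow> char \<mu> t"
    by simp
qed

text \<open>
  If \<open>V n\<close> estimates \<open>v\<close> with mean square error of order \<open>1 / n\<close>, then linearising a function that is
  differentiable at \<open>v\<close> costs an error of smaller order than \<open>1 / sqrt n\<close> in probability.
\<close>
lemma delta_method_remainder:
  fixes V :: "nat \<Rightarrow> 'a \<Rightarrow> 'b::euclidean_space" and F :: "'b \<Rightarrow> real"
  assumes V [measurable]: "\<And>n. V n \<in> borel_measurable M" and F [measurable]: "F \<in> borel_measurable borel"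
    and F': "(F has_derivative F') (at v)"
    and int: "\<And>n. n > 0 \<Longrightarrow> integrable M (\<lambda>x. (norm (V n x - v))\<^sup>2)"
    and bound: "\<And>n. n > 0 \<Longrightarrow> expectation (\<lambda>x. (norm (V n x - v))\<^sup>2) \<le> C / real n"
    and \<epsilon>: "\<epsilon> > 0"
  shows "(\<lambda>n. prob {x \<in> space M. \<bar>sqrt (real n) * (F (V n x) - F v - F' (V n x - v))\<bar> \<ge> \<epsilon>}) \<longlonglongrightarrow> 0"
proof (rule LIMSEQ_I)
  fix r :: real assume r: "r > 0"
  interpret F': bounded_linear F' using F' by (rule has_derivative_bounded_linear)
  have [measurable]: "F' \<in> borel_measurable borel"
    by (intro borel_measurable_continuous_onI linear_continuous_on F'.bounded_linear_axioms)
  define C' where "C' = max C 0 + 1"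
  have C': "C' > 0" "C \<le> C'" by (auto simp: C'_def)
  define e where "e = sqrt (r * \<epsilon>\<^sup>2 / (2 * C'))"
  have e: "e > 0" "C' * e\<^sup>2 / \<epsilon>\<^sup>2 = r / 2" using r \<epsilon> C' by (auto simp: e_def)
  obtain d where d: "d > 0" "\<And>y. norm (y - v) < d \<Longrightarrow> \<bar>F y - F v - F' (y - v)\<bar> \<le> e * norm (y - v)"
    using F' e(1) unfolding has_derivative_at_alt by (auto simp: real_norm_def)
  obtain N :: nat where N: "real N > (\<epsilon> / (e * d))\<^sup>2" using reals_Archimedean2 by blast
  have "prob {x \<in> space M. \<bar>sqrt (real n) * (F (V n x) - F v - F' (V n x - v))\<bar> \<ge> \<epsilon>} < r" if n: "n \<ge> Suc N" for n
  proof -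
    have n0: "real n > 0" "n > 0" using n by auto
    define c where "c = \<epsilon> / (e * sqrt (real n))"
    have c: "c > 0" using \<epsilon> e n0 by (simp add: c_def)
    have "real n > (\<epsilon> / (e * d))\<^sup>2" using N n by linarith
    hence "sqrt (real n) > \<epsilon> / (e * d)" by (rule real_less_rsqrt)
    hence cd: "c < d" using e d \<epsilon> n0 by (simp add: c_def field_simps)
    \<comment> \<open>Below distance \<open>d\<close> the remainder is at most \<open>e * norm (V n x - v)\<close>, so it can only be large\<close>
    \<comment> \<open>if \<open>V n x\<close> is at distance at least \<open>c\<close> from \<open>v\<close>; for \<open>n > N\<close> one has \<open>c < d\<close>.\<close>
    have sub: "{x \<in> space M. \<bar>sqrt (real n) * (F (V n x) - F v - F' (V n x - v))\<bar> \<ge> \<epsilon>}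
        \<subseteq> {x \<in> space M. (norm (V n x - v))\<^sup>2 \<ge> c\<^sup>2}"
    proof safe
      fix x assume x: "x \<in> space M" and "\<epsilon> \<le> \<bar>sqrt (real n) * (F (V n x) - F v - F' (V n x - v))\<bar>"
      hence big: "\<epsilon> \<le> sqrt (real n) * \<bar>F (V n x) - F v - F' (V n x - v)\<bar>"
        by (simp add: abs_mult)
      have "norm (V n x - v) \<ge> c"
      proof (cases "norm (V n x - v) < d")
        case True
        have "\<epsilon> \<le> sqrt (real n) * (e * norm (V n x - v))"
          by (rule order.trans[OF big mult_left_mono[OF d(2)[OF True]]]) auto
        thus ?thesis using e n0 by (simp add: c_def field_simps)
      qed (use cd in auto)
      thus "c\<^sup>2 \<le> (norm (V n x - v))\<^sup>2" using c by (intro power_mono) auto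
    qed
    have "prob {x \<in> space M. \<bar>sqrt (real n) * (F (V n x) - F v - F' (V n x - v))\<bar> \<ge> \<epsilon>}
        \<le> prob {x \<in> space M. (norm (V n x - v))\<^sup>2 \<ge> c\<^sup>2}"
      by (rule finite_measure_mono[OF sub]) measurable
    also have "\<dots> \<le> expectation (\<lambda>x. (norm (V n x - v))\<^sup>2) / c\<^sup>2"
      by (rule integral_Markov_inequality_measure[where A = "space M"]) (use int[OF n0(2)] c in auto)
    also have "\<dots> \<le> (C' / real n) / c\<^sup>2"
      using order.trans[OF bound[OF n0(2)] divide_right_mono[OF C'(2)]] by (intro divide_right_mono) auto
    also have "\<dots> = C' * e\<^sup>2 / \<epsilon>\<^sup>2"
      using n0 e(1) \<epsilon> by (simp add: c_def power_divide power_mult_distrib)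
    also have "\<dots> < r" using e(2) r by simp
    finally show ?thesis .
  qed
  thus "\<exists>N. \<forall>n\<ge>N. norm (prob {x \<in> space M. \<bar>sqrt (real n) * (F (V n x) - F v - F' (V n x - v))\<bar> \<ge> \<epsilon>} - 0) < r"
    by (auto intro!: exI[of _ "Suc N"])
qed

end

lemma real_distribution_normal_law: "v > 0 \<Longrightarrow> real_distribution (normal_law m v)"
  unfolding normal_law_def real_distribution_def real_distribution_axioms_def
  by (auto intro: prob_space_normal_density)

lemma normal_law_eq_distr:
  assumes "\<sigma> > 0"
  shows "normal_law 0 (\<sigma>\<^sup>2) = distr std_normal_distribution borel (\<lambda>x. \<sigma> * x)"
proof -
  interpret prob_space std_normal_distribution by (rule prob_space_normal_density) simp
  have "distributed std_normal_distribution lborel (\<lambda>x. x) (normal_density 0 1)"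
    by (auto simp: distributed_def distr_id2)
  from normal_density_affine[OF this, of \<sigma> 0] assms
  have "distr std_normal_distribution lborel (\<lambda>x. \<sigma> * x) = density lborel (normal_density 0 \<sigma>)"
    by (simp add: distributed_def)
  moreover have "distr std_normal_distribution lborel (\<lambda>x. \<sigma> * x) = distr std_normal_distribution borel (\<lambda>x. \<sigma> * x)"
    by (rule distr_cong) auto
  ultimately show ?thesis using assms by (simp add: normal_law_def)
qed

lemma (in prob_space) central_limit_normal_law:
  fixes Z :: "nat \<Rightarrow> 'a \<Rightarrow> real"
  assumes indep: "indep_vars (\<lambda>i. borel) Z UNIV" and mean: "\<And>n. expectation (Z n) = 0"
    and \<sigma>: "\<sigma> > 0" and int: "\<And>n. integrable M (\<lambda>x. (Z n x)\<^sup>2)"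
    and var: "\<And>n. expectation (\<lambda>x. (Z n x)\<^sup>2) = \<sigma>\<^sup>2"
    and dist: "\<And>n. distr M borel (Z n) = \<mu>"
  shows "weak_conv_m (\<lambda>n. distr M borel (\<lambda>x. sqrt (real n) * ((\<Sum>i<n. Z i x) / real n))) (normal_law 0 (\<sigma>\<^sup>2))"
proof (rule levy_continuity)
  have [measurable]: "Z n \<in> borel_measurable M" for n using indep by (auto simp: indep_vars_def)
  show "real_distribution (distr M borel (\<lambda>x. sqrt (real n) * ((\<Sum>i<n. Z i x) / real n)))" for n
    by (rule real_distribution_distr) measurable
  show "real_distribution (normal_law 0 (\<sigma>\<^sup>2))" using \<sigma> by (intro real_distribution_normal_law) simp
  fix t :: real
  have "weak_conv_m (\<lambda>n. distr M borel (\<lambda>x. (\<Sum>i<n. Z i x) / sqrt (n * \<sigma>\<^sup>2))) std_normal_distribution"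
    by (rule central_limit_theorem_zero_mean[OF indep mean \<sigma> int _ dist]) (simp add: mean var)
  hence "(\<lambda>n. char (distr M borel (\<lambda>x. (\<Sum>i<n. Z i x) / sqrt (n * \<sigma>\<^sup>2))) (t * \<sigma>)) \<longlonglongrightarrow> char std_normal_distribution (t * \<sigma>)"
    by (intro levy_continuity1 real_dist_normal_dist real_distribution_distr) measurable
  also have "char std_normal_distribution (t * \<sigma>) = char (normal_law 0 (\<sigma>\<^sup>2)) t"
    unfolding normal_law_eq_distr[OF \<sigma>] char_def by (subst integral_distr) (auto simp: mult_ac)
  also have "(\<lambda>n. char (distr M borel (\<lambda>x. (\<Sum>i<n. Z i x) / sqrt (n * \<sigma>\<^sup>2))) (t * \<sigma>)) =
      (\<lambda>n. char (distr M borel (\<lambda>x. sqrt (real n) * ((\<Sum>i<n. Z i x) / real n))) t)"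
  proof
    fix n :: nat
    have "\<sigma> * ((\<Sum>i<n. Z i x) / sqrt (n * \<sigma>\<^sup>2)) = sqrt (real n) * ((\<Sum>i<n. Z i x) / real n)" for x
      using \<sigma> by (cases "n = 0") (auto simp: real_sqrt_mult field_simps)
    hence "t * \<sigma> * ((\<Sum>i<n. Z i x) / sqrt (n * \<sigma>\<^sup>2)) = t * (sqrt (real n) * ((\<Sum>i<n. Z i x) / real n))" for x
      by (metis mult.assoc)
    thus "char (distr M borel (\<lambda>x. (\<Sum>i<n. Z i x) / sqrt (n * \<sigma>\<^sup>2))) (t * \<sigma>) =
        char (distr M borel (\<lambda>x. sqrt (real n) * ((\<Sum>i<n. Z i x) / real n))) t"
      by (subst (1 2) char_distr) auto
  qed
  finally show "(\<lambda>n. char (distr M borel (\<lambda>x. sqrt (real n) * ((\<Sum>i<n. Z i x) / real n))) t) \<longlonglongrightarrow> char (normal_law 0 (\<sigma>\<^sup>2)) t" .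
qed

section \<open>The rate estimators\<close>

text \<open>
  The estimator of a rate as a function of the triple \<open>(a, y, z)\<close> of sample means: \<open>a\<close> is the observed
  proportion of the event type, \<open>y\<close> the mean of the shifted logarithms \<open>ln S + ln \<theta> / \<alpha> + euler_mascheroni\<close>,
  and \<open>z\<close> the mean of their squares. The sample variance of \<open>ln S\<close> is then \<open>z - y\<^sup>2\<close>, and the mean of
  \<open>ln S\<close> plus \<open>euler_mascheroni\<close> is \<open>y - ln \<theta> / \<alpha>\<close>; the parameters \<open>\<alpha>\<close> and \<open>\<theta>\<close> only undo the shift.
\<close>
definition rate_of_moments :: "real \<Rightarrow> real \<Rightarrow> real \<times> real \<times> real \<Rightarrow> real" where
  "rate_of_moments \<alpha> \<theta> = (\<lambda>x. fst x * exp (- (pi / sqrt (3 * (snd (snd x) - (fst (snd x))\<^sup>2 + pi\<^sup>2 / 6)))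
     * (fst (snd x) - ln \<theta> / \<alpha>)))"

lemma rate_of_moments_measurable [measurable]: "rate_of_moments \<alpha> \<theta> \<in> borel_measurable borel"
proof -
  have [measurable]: "(fst :: real \<times> real \<times> real \<Rightarrow> _) \<in> borel_measurable borel"
    "(\<lambda>x :: real \<times> real \<times> real. fst (snd x)) \<in> borel_measurable borel"
    "(\<lambda>x :: real \<times> real \<times> real. snd (snd x)) \<in> borel_measurable borel"
    by (auto intro!: borel_measurable_continuous_onI continuous_intros)
  show ?thesis unfolding rate_of_moments_def by measurable
qed

lemma rate_of_moments_derivative:
  fixes \<alpha> \<theta> p :: real
  assumes \<alpha>: "\<alpha> > 0" and \<theta>: "\<theta> > 0"
  defines "v \<equiv> (p, 0, pi\<^sup>2 / (3 * \<alpha>\<^sup>2) - pi\<^sup>2 / 6)"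
  shows "rate_of_moments \<alpha> \<theta> v = p * \<theta>"
    and "(rate_of_moments \<alpha> \<theta> has_derivative (\<lambda>h. \<theta> * fst h - p * \<alpha> * \<theta> * fst (snd h)
      - p * (3 * \<alpha>\<^sup>2 * \<theta> * ln \<theta> / (2 * pi\<^sup>2)) * snd (snd h))) (at v)"
proof -
  define D where "D x = 3 * (snd (snd x) - (fst (snd x))\<^sup>2 + pi\<^sup>2 / 6)" for x :: "real \<times> real \<times> real"
  define G where "G x = - (pi / sqrt (D x)) * (fst (snd x) - ln \<theta> / \<alpha>)" for x :: "real \<times> real \<times> real"
  have Dv: "D v = (pi / \<alpha>)\<^sup>2" by (simp add: D_def v_def power_divide)
  have sqv: "sqrt (D v) = pi / \<alpha>" unfolding Dv using \<alpha> by (intro real_sqrt_unique) auto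
  have Dpos: "D v > 0" unfolding Dv using \<alpha> by simp
  have F_eq: "rate_of_moments \<alpha> \<theta> = (\<lambda>x. fst x * exp (G x))"
    by (simp add: rate_of_moments_def G_def D_def)
  have Gv: "G v = ln \<theta>" unfolding G_def sqv using \<alpha> by (simp add: v_def)
  show "rate_of_moments \<alpha> \<theta> v = p * \<theta>" unfolding F_eq Gv using \<theta> by (simp add: v_def)
  have dD: "(D has_derivative (\<lambda>h. 3 * snd (snd h))) (at v)"
    unfolding D_def by (auto intro!: derivative_eq_intros simp: v_def)
  have "((\<lambda>d. pi / sqrt d) has_real_derivative - (pi * (inverse (sqrt (D v)) / 2) / (sqrt (D v))\<^sup>2)) (at (D v))"
    using Dpos by (auto intro!: derivative_eq_intros simp: power2_eq_square)
  also have "- (pi * (inverse (sqrt (D v)) / 2) / (sqrt (D v))\<^sup>2) = - (\<alpha> ^ 3) / (2 * pi\<^sup>2)"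
    unfolding sqv using \<alpha> by (simp add: field_simps power2_eq_square power3_eq_cube)
  finally have dA: "((\<lambda>x. pi / sqrt (D x)) has_derivative (\<lambda>h. 3 * snd (snd h) * (- (\<alpha> ^ 3) / (2 * pi\<^sup>2)))) (at v)"
    using dD by (rule DERIV_compose_FDERIV)
  have dL: "((\<lambda>x. fst (snd x) - ln \<theta> / \<alpha>) has_derivative (\<lambda>h. fst (snd h))) (at v)"
    by (auto intro!: derivative_eq_intros)
  have dG: "(G has_derivative (\<lambda>h. - \<alpha> * fst (snd h) - 3 * \<alpha>\<^sup>2 * ln \<theta> / (2 * pi\<^sup>2) * snd (snd h))) (at v)"
  proof -
    have g1: "G = (\<lambda>x. - ((pi / sqrt (D x)) * (fst (snd x) - ln \<theta> / \<alpha>)))" by (auto simp: G_def)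
    have g2: "((\<lambda>x. - ((pi / sqrt (D x)) * (fst (snd x) - ln \<theta> / \<alpha>))) has_derivative
       (\<lambda>h. - ((pi / sqrt (D v)) * fst (snd h) + 3 * snd (snd h) * (- (\<alpha> ^ 3) / (2 * pi\<^sup>2)) * (fst (snd v) - ln \<theta> / \<alpha>)))) (at v)"
      by (intro has_derivative_minus has_derivative_mult dA dL)
    have g3: "(\<lambda>h. - ((pi / sqrt (D v)) * fst (snd h) + 3 * snd (snd h) * (- (\<alpha> ^ 3) / (2 * pi\<^sup>2)) * (fst (snd v) - ln \<theta> / \<alpha>)))
      = (\<lambda>h. - \<alpha> * fst (snd h) - 3 * \<alpha>\<^sup>2 * ln \<theta> / (2 * pi\<^sup>2) * snd (snd h))"
      unfolding sqv using \<alpha> by (auto simp: v_def field_simps power2_eq_square power3_eq_cube)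
    show ?thesis using g2 unfolding g1[symmetric] g3 .
  qed
  have "(exp has_real_derivative exp (G v)) (at (G v))" by (rule DERIV_exp)
  hence dE: "((\<lambda>x. exp (G x)) has_derivative (\<lambda>h. (- \<alpha> * fst (snd h) - 3 * \<alpha>\<^sup>2 * ln \<theta> / (2 * pi\<^sup>2) * snd (snd h)) * exp (G v))) (at v)"
    using dG by (rule DERIV_compose_FDERIV)
  have df: "((\<lambda>x :: real \<times> real \<times> real. fst x) has_derivative fst) (at v)"
    by (auto intro!: derivative_eq_intros)
  have "((\<lambda>x. fst x * exp (G x)) has_derivative (\<lambda>h. fst v * ((- \<alpha> * fst (snd h) - 3 * \<alpha>\<^sup>2 * ln \<theta> / (2 * pi\<^sup>2) * snd (snd h)) * exp (G v))
      + fst h * exp (G v))) (at v)"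
    by (rule has_derivative_mult[OF df dE])
  moreover have "(\<lambda>h. fst v * ((- \<alpha> * fst (snd h) - 3 * \<alpha>\<^sup>2 * ln \<theta> / (2 * pi\<^sup>2) * snd (snd h)) * exp (G v))
      + fst h * exp (G v)) = (\<lambda>h. \<theta> * fst h - p * \<alpha> * \<theta> * fst (snd h)
      - p * (3 * \<alpha>\<^sup>2 * \<theta> * ln \<theta> / (2 * pi\<^sup>2)) * snd (snd h))"
    unfolding Gv using \<theta> by (auto simp: v_def algebra_simps)
  ultimately show "(rate_of_moments \<alpha> \<theta> has_derivative (\<lambda>h. \<theta> * fst h - p * \<alpha> * \<theta> * fst (snd h)
      - p * (3 * \<alpha>\<^sup>2 * \<theta> * ln \<theta> / (2 * pi\<^sup>2)) * snd (snd h))) (at v)"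
    unfolding F_eq by simp
qed

text \<open>
  The left-hand side is the variance of \<open>\<alpha> * \<theta> * Y + c * (Y\<^sup>2 - q)\<close>, expressed by the second, third and
  fourth moments of \<open>Y\<close>.
\<close>
lemma sigma_theta_sq_eq_moments:
  fixes \<alpha> \<theta> :: real
  assumes "\<alpha> > 0" "\<theta> > 0"
  defines "q \<equiv> pi\<^sup>2 / (3 * \<alpha>\<^sup>2) - pi\<^sup>2 / 6" and "c \<equiv> 3 * \<alpha>\<^sup>2 * \<theta> * ln \<theta> / (2 * pi\<^sup>2)"
  shows "(\<alpha> * \<theta>)\<^sup>2 * q + 2 * (\<alpha> * \<theta>) * c * (- 2 * zeta 3)
    + c\<^sup>2 * (pi ^ 4 * (2 / \<alpha> ^ 4 - 1) / 15 + 3 * q\<^sup>2 - q\<^sup>2) = sigma_theta_sq \<alpha> \<theta>"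
proof -
  have q: "q = pi\<^sup>2 * (2 - \<alpha>\<^sup>2) / (6 * \<alpha>\<^sup>2)" using assms by (simp add: q_def field_simps)
  have 1: "(\<alpha> * \<theta>)\<^sup>2 * q = \<theta>\<^sup>2 * (pi\<^sup>2 * (2 - \<alpha>\<^sup>2) / 6)"
    unfolding q using assms(1) by (simp add: power_mult_distrib)
  have 2: "2 * (\<alpha> * \<theta>) * c * (- 2 * zeta 3) = \<theta>\<^sup>2 * (- 6 * \<alpha> ^ 3 * ln \<theta> * zeta 3 / pi\<^sup>2)"
    unfolding c_def by (simp add: power2_eq_square power3_eq_cube field_simps)
  have "pi ^ 4 * (2 / \<alpha> ^ 4 - 1) / 15 + 3 * q\<^sup>2 - q\<^sup>2 = pi ^ 4 / \<alpha> ^ 4 * ((2 - \<alpha> ^ 4) / 15 + (2 - \<alpha>\<^sup>2)\<^sup>2 / 18)"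
    unfolding q using assms(1) by (simp add: field_simps power2_eq_square eval_nat_numeral)
  also have "c\<^sup>2 * \<dots> = \<theta>\<^sup>2 * (ln \<theta>)\<^sup>2 * (9 / 4) * ((2 - \<alpha> ^ 4) / 15 + (2 - \<alpha>\<^sup>2)\<^sup>2 / 18)"
    unfolding c_def using assms(1) by (simp add: power_mult_distrib power_divide flip: power_mult)
  finally have 3: "c\<^sup>2 * (pi ^ 4 * (2 / \<alpha> ^ 4 - 1) / 15 + 3 * q\<^sup>2 - q\<^sup>2) =
      \<theta>\<^sup>2 * (ln \<theta>)\<^sup>2 * (9 / 4) * ((2 - \<alpha> ^ 4) / 15 + (2 - \<alpha>\<^sup>2)\<^sup>2 / 18)" .
  show ?thesis
    unfolding 1 2 3 sigma_theta_sq_def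
    by (simp add: field_simps power2_eq_square eval_nat_numeral)
qed

text \<open>
  The limit theorem for the rate of one event type, which has probability \<open>p\<close> and rate \<open>p * \<theta>\<close>.
\<close>
lemma (in prob_space) rate_hat_weak_conv:
  fixes S :: "nat \<Rightarrow> 'a \<Rightarrow> real" and K :: "nat \<Rightarrow> 'a \<Rightarrow> queue_event"
  assumes \<alpha>: "0 < \<alpha>" "\<alpha> \<le> 1" and \<theta>: "\<theta> > 0" and p: "0 < p" "p < 1"
    and S_indep: "indep_vars (\<lambda>_. borel) S UNIV"
    and S_law: "\<And>j. distributed M lborel (S j) (\<lambda>t. ennreal (ml_waiting_density \<alpha> \<theta> t))"
    and K_indep: "indep_vars (\<lambda>_. count_space UNIV) K UNIV"
    and K_law: "\<And>j. prob {\<omega> \<in> space M. K j \<omega> = e} = p"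
    and S_K_indep: "indep_rv_pair M
      (Pi\<^sub>M UNIV (\<lambda>_. borel)) (\<lambda>\<omega> j. S j \<omega>)
      (Pi\<^sub>M UNIV (\<lambda>_. count_space UNIV)) (\<lambda>\<omega> j. K j \<omega>)"
  shows "weak_conv_m (\<lambda>n. distr M borel (\<lambda>\<omega>. sqrt (real n) * (rate_hat S K e n \<omega> - p * \<theta>)))
       (normal_law 0 (\<theta>\<^sup>2 * p * (1 - p) + p\<^sup>2 * sigma_theta_sq \<alpha> \<theta>))"
proof -
  have Sm [measurable]: "S j \<in> borel_measurable M" for j using S_indep by (auto simp: indep_vars_def)
  have Km [measurable]: "K j \<in> measurable M (count_space UNIV)" for j using K_indep by (auto simp: indep_vars_def)
  \<comment> \<open>Real-valued, because \<open>indep_var\<close> needs both variables to have the same type.\<close>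
  define B where "B j x = (if K j x = e then 1 else 0 :: real)" for j x
  define y where "y s = ln s + ln \<theta> / \<alpha> + euler_mascheroni" for s :: real
  define Y where "Y j x = y (S j x)" for j x
  define q where "q = pi\<^sup>2 / (3 * \<alpha>\<^sup>2) - pi\<^sup>2 / 6"
  define c where "c = 3 * \<alpha>\<^sup>2 * \<theta> * ln \<theta> / (2 * pi\<^sup>2)"
  define \<kappa>4 where "\<kappa>4 = pi ^ 4 * (2 / \<alpha> ^ 4 - 1) / 15 + 3 * q\<^sup>2"
  have [measurable]: "y \<in> borel_measurable borel" unfolding y_def by measurable
  have [measurable]: "B j \<in> borel_measurable M" for j unfolding B_def by measurable
  have [measurable]: "Y j \<in> borel_measurable M" for j unfolding Y_def by measurable
  note lap = ml_waiting_time_laplace[OF prob_space_axioms \<alpha> \<theta> S_law]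
  note mom = log_moments_of_laplace[OF Sm lap(1) \<alpha> \<theta> lap(2)]
  have Yint: "integrable M (\<lambda>x. Y j x ^ k)" for j k
    using mom(1)[of j k] by (simp add: Y_def y_def)
  have Y1: "expectation (\<lambda>x. Y j x) = 0" and Y2: "expectation (\<lambda>x. (Y j x)\<^sup>2) = q"
    and Y3: "expectation (\<lambda>x. Y j x ^ 3) = - 2 * zeta 3" and Y4: "expectation (\<lambda>x. Y j x ^ 4) = \<kappa>4" for j
    using mom(2-5)[of j] unfolding Y_def y_def q_def \<kappa>4_def by simp_all
  have Yint1: "integrable M (Y j)" for j using Yint[of j 1] by simp

  have Bint: "integrable M (B j)" for j
    by (rule integrable_const_bound[where B = 1]) (auto simp: B_def)
  have B1: "expectation (B j) = p" for j
  proof -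
    have "expectation (B j) = expectation (indicat_real {\<omega> \<in> space M. K j \<omega> = e})"
      by (intro Bochner_Integration.integral_cong) (auto simp: B_def)
    thus ?thesis using K_law[of j] by simp
  qed
  have B2: "(B j x - p)\<^sup>2 = (1 - 2 * p) * B j x + p\<^sup>2" for j x
    by (simp add: B_def power2_eq_square algebra_simps)

  have pairs: "indep_vars (\<lambda>_. borel \<Otimes>\<^sub>M count_space UNIV) (\<lambda>j \<omega>. (S j \<omega>, K j \<omega>)) UNIV"
    by (rule indep_vars_of_independent_sequences(1)[OF S_indep K_indep S_K_indep])
  have SB: "indep_var borel (S j) borel (B j)" for j
  proof (rule indep_varI_rectangles)
    fix C D :: "real set" assume C: "C \<in> sets borel"
    define E where "E = {k. (if k = e then 1 else 0) \<in> D}"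
    have "B j -` D = K j -` E" by (auto simp: B_def E_def)
    thus "prob (S j -` C \<inter> B j -` D \<inter> space M) = prob (S j -` C \<inter> space M) * prob (B j -` D \<inter> space M)"
      using indep_vars_of_independent_sequences(2)[OF S_indep K_indep S_K_indep C, of E j] by simp
  qed measurable
  have S_dist: "distr M borel (S j) = distr M borel (S 0)" for j
  proof -
    have "distr M borel (S i) = density lborel (\<lambda>t. ennreal (ml_waiting_density \<alpha> \<theta> t))" for i
    proof -
      have "distr M borel (S i) = distr M lborel (S i)" by (rule distr_cong) auto
      thus ?thesis using S_law[of i] by (simp add: distributed_def)
    qed
    thus ?thesis by simp
  qed
  have B_dist: "distr M borel (B j) = distr M borel (B 0)" for j
  proof (rule measure_eqI)
    fix D assume "D \<in> sets (distr M borel (B j))"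
    hence D [measurable]: "D \<in> sets borel" by simp
    have "emeasure (distr M borel (B i)) D = ennreal (indicator D 1 * p + indicator D 0 * (1 - p))" for i
    proof -
      have "emeasure (distr M borel (B i)) D = emeasure M (B i -` D \<inter> space M)"
        by (rule emeasure_distr) measurable
      also have "\<dots> = ennreal (prob (B i -` D \<inter> space M))" by (simp add: emeasure_eq_measure)
      also have "prob (B i -` D \<inter> space M) = expectation (\<lambda>x. indicator D 1 * B i x + indicator D 0 * (1 - B i x))"
      proof -
        have "prob (B i -` D \<inter> space M) = expectation (indicat_real (B i -` D \<inter> space M))" by simp
        also have "\<dots> = expectation (\<lambda>x. indicator D 1 * B i x + indicator D 0 * (1 - B i x))"
          by (intro Bochner_Integration.integral_cong) (auto simp: B_def indicator_def)
        finally show ?thesis .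
      qed
      also have "\<dots> = indicator D 1 * p + indicator D 0 * (1 - p)"
        using Bint[of i] B1[of i] by (simp add: prob_space)
      finally show ?thesis .
    qed
    thus "emeasure (distr M borel (B j)) D = emeasure (distr M borel (B 0)) D" by simp
  qed simp
  have SB_dist: "distr M (borel \<Otimes>\<^sub>M borel) (\<lambda>x. (S j x, B j x)) = distr M (borel \<Otimes>\<^sub>M borel) (\<lambda>x. (S 0 x, B 0 x))" for j
    using SB[unfolded indep_var_distribution_eq] S_dist[of j] B_dist[of j] by metis

  \<comment> \<open>The centred summands: \<open>Z\<close> is the linearised estimator, \<open>T\<close> its part depending on the waiting time.\<close>
  define W1 where "W1 j x = B j x - p" for j x
  define W2 where "W2 j x = (Y j x)\<^sup>2 - q" for j x
  define T where "T j x = p * (\<alpha> * \<theta> * Y j x + c * W2 j x)" for j x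
  define Z where "Z j x = \<theta> * W1 j x - T j x" for j x
  have [measurable]: "W1 j \<in> borel_measurable M" "W2 j \<in> borel_measurable M" "T j \<in> borel_measurable M"
    "Z j \<in> borel_measurable M" for j
    unfolding W1_def W2_def T_def Z_def by measurable
  have W1_indep: "indep_vars (\<lambda>_. borel) W1 UNIV"
  proof -
    have "indep_vars (\<lambda>_. borel) (\<lambda>j x. (\<lambda>z. (if snd z = e then 1 else 0) - p) (S j x, K j x)) UNIV"
      by (rule indep_vars_compose2[OF pairs]) measurable
    thus ?thesis by (simp add: W1_def[abs_def] B_def)
  qed
  have Y_indep: "indep_vars (\<lambda>_. borel) Y UNIV"
    unfolding Y_def[abs_def] by (rule indep_vars_compose2[OF S_indep]) measurable
  have W2_indep: "indep_vars (\<lambda>_. borel) W2 UNIV"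
    unfolding W2_def[abs_def] by (rule indep_vars_compose2[OF Y_indep]) measurable
  have Z_indep: "indep_vars (\<lambda>_. borel) Z UNIV"
  proof -
    have "indep_vars (\<lambda>_. borel) (\<lambda>j x. (\<lambda>z. \<theta> * ((if snd z = e then 1 else 0) - p) -
        p * (\<alpha> * \<theta> * y (fst z) + c * ((y (fst z))\<^sup>2 - q))) (S j x, K j x)) UNIV"
      by (rule indep_vars_compose2[OF pairs]) measurable
    thus ?thesis by (simp add: Z_def[abs_def] T_def W1_def W2_def Y_def B_def)
  qed
  have Z_dist: "distr M borel (Z j) = distr M borel (Z 0)" for j
  proof -
    define f where "f z = \<theta> * (snd z - p) - p * (\<alpha> * \<theta> * y (fst z) + c * ((y (fst z))\<^sup>2 - q))" for z
    have [measurable]: "f \<in> borel_measurable (borel \<Otimes>\<^sub>M borel)" unfolding f_def by measurable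
    have "distr M borel (Z i) = distr (distr M (borel \<Otimes>\<^sub>M borel) (\<lambda>x. (S i x, B i x))) borel f" for i
      by (subst distr_distr) (auto simp: comp_def f_def Z_def[abs_def] T_def W1_def W2_def Y_def)
    thus ?thesis using SB_dist[of j] by simp
  qed

  have W1int: "integrable M (W1 j)" for j unfolding W1_def[abs_def] using Bint by simp
  have W1sq: "integrable M (\<lambda>x. (W1 j x)\<^sup>2)" "expectation (\<lambda>x. (W1 j x)\<^sup>2) = p * (1 - p)" for j
    unfolding W1_def B2 using Bint[of j] B1[of j]
    by (simp_all add: prob_space power2_eq_square algebra_simps)
  have W1mean: "expectation (W1 j) = 0" for j
    unfolding W1_def[abs_def] using Bint[of j] B1[of j] by (simp add: prob_space)
  have W2mean: "expectation (W2 j) = 0" for j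
    unfolding W2_def[abs_def] using Yint[of j 2] Y2[of j] by (simp add: prob_space)
  have W2_eq: "(W2 j x)\<^sup>2 = Y j x ^ 4 - 2 * q * (Y j x)\<^sup>2 + q\<^sup>2" for j x
    by (simp add: W2_def power2_eq_square eval_nat_numeral algebra_simps)
  have W2sq: "integrable M (\<lambda>x. (W2 j x)\<^sup>2)" "expectation (\<lambda>x. (W2 j x)\<^sup>2) = \<kappa>4 - q\<^sup>2" for j
    unfolding W2_eq using Yint[of j 4] Yint[of j 2] Y2[of j] Y4[of j]
    by (simp_all add: prob_space power2_eq_square)
  have T_eq: "(T j x)\<^sup>2 = p\<^sup>2 * ((\<alpha> * \<theta>)\<^sup>2 * (Y j x)\<^sup>2 + 2 * (\<alpha> * \<theta>) * c * (Y j x ^ 3 - q * Y j x) + c\<^sup>2 * (W2 j x)\<^sup>2)" for j x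
    by (simp add: T_def W2_def power2_eq_square eval_nat_numeral algebra_simps)
  have Tsq: "integrable M (\<lambda>x. (T j x)\<^sup>2)" "expectation (\<lambda>x. (T j x)\<^sup>2) = p\<^sup>2 * sigma_theta_sq \<alpha> \<theta>" for j
  proof -
    show "integrable M (\<lambda>x. (T j x)\<^sup>2)"
      unfolding T_eq using Yint[of j 2] Yint[of j 3] Yint1[of j] W2sq(1)[of j] by simp
    have "expectation (\<lambda>x. (T j x)\<^sup>2) = p\<^sup>2 * ((\<alpha> * \<theta>)\<^sup>2 * q + 2 * (\<alpha> * \<theta>) * c * (- 2 * zeta 3) + c\<^sup>2 * (\<kappa>4 - q\<^sup>2))"
      unfolding T_eq using Yint[of j 2] Yint[of j 3] Yint1[of j] W2sq[of j] Y1[of j] Y2[of j] Y3[of j] by simp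
    also have "(\<alpha> * \<theta>)\<^sup>2 * q + 2 * (\<alpha> * \<theta>) * c * (- 2 * zeta 3) + c\<^sup>2 * (\<kappa>4 - q\<^sup>2) = sigma_theta_sq \<alpha> \<theta>"
      unfolding \<kappa>4_def q_def c_def by (rule sigma_theta_sq_eq_moments[OF \<alpha>(1) \<theta>])
    finally show "expectation (\<lambda>x. (T j x)\<^sup>2) = p\<^sup>2 * sigma_theta_sq \<alpha> \<theta>" .
  qed
  have Tint: "integrable M (T j)" for j
    by (rule square_integrable_imp_integrable[OF _ Tsq(1)]) measurable
  have Tmean: "expectation (T j) = 0" for j
  proof -
    have "integrable M (W2 j)"
      by (rule square_integrable_imp_integrable[OF _ W2sq(1)]) measurable
    thus ?thesis unfolding T_def[abs_def] using Yint1[of j] Y1[of j] W2mean[of j] by simp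
  qed
  have cross: "integrable M (\<lambda>x. T j x * W1 j x)" "expectation (\<lambda>x. T j x * W1 j x) = 0" for j
  proof -
    have "indep_var borel ((\<lambda>s. p * (\<alpha> * \<theta> * y s + c * ((y s)\<^sup>2 - q))) \<circ> S j) borel ((\<lambda>b. b - p) \<circ> B j)"
      by (rule indep_var_compose[OF SB]) measurable
    hence ind: "indep_var borel (T j) borel (W1 j)"
      by (simp add: comp_def T_def[abs_def] W1_def[abs_def] W2_def Y_def)
    show "integrable M (\<lambda>x. T j x * W1 j x)" by (rule indep_var_integrable[OF ind Tint W1int])
    show "expectation (\<lambda>x. T j x * W1 j x) = 0"
      using indep_var_lebesgue_integral[OF ind Tint W1int] W1mean by simp
  qed
  \<comment> \<open>The variance of \<open>Z\<close>; it is positive because of the contribution of the event types.\<close>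
  define \<sigma>2 where "\<sigma>2 = \<theta>\<^sup>2 * p * (1 - p) + p\<^sup>2 * sigma_theta_sq \<alpha> \<theta>"
  have Z_eq: "(Z j x)\<^sup>2 = \<theta>\<^sup>2 * (W1 j x)\<^sup>2 + (T j x)\<^sup>2 - 2 * \<theta> * (T j x * W1 j x)" for j x
    by (simp add: Z_def power2_eq_square algebra_simps)
  have Zsq: "integrable M (\<lambda>x. (Z j x)\<^sup>2)" "expectation (\<lambda>x. (Z j x)\<^sup>2) = \<sigma>2" for j
    unfolding Z_eq \<sigma>2_def using W1sq[of j] Tsq[of j] cross[of j] by simp_all
  have Zmean: "expectation (Z j) = 0" for j
    unfolding Z_def[abs_def] using W1int[of j] Tint[of j] W1mean[of j] Tmean[of j] by simp
  have \<sigma>2: "\<sigma>2 > 0"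
  proof -
    have "p\<^sup>2 * sigma_theta_sq \<alpha> \<theta> \<ge> 0" unfolding Tsq(2)[of 0, symmetric] by simp
    moreover have "\<theta>\<^sup>2 * p * (1 - p) > 0" using \<theta> p by simp
    ultimately show ?thesis unfolding \<sigma>2_def by linarith
  qed
  have clt: "weak_conv_m (\<lambda>n. distr M borel (\<lambda>x. sqrt (real n) * ((\<Sum>i<n. Z i x) / real n))) (normal_law 0 \<sigma>2)"
  proof -
    have "(sqrt \<sigma>2)\<^sup>2 = \<sigma>2" using \<sigma>2 by simp
    thus ?thesis
      using central_limit_normal_law[OF Z_indep Zmean _ Zsq(1) _ Z_dist, of "sqrt \<sigma>2"] Zsq(2) \<sigma>2 by simp
  qed

  \<comment> \<open>Sample means and the linearisation of the estimator at their expectations.\<close>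
  define v where "v = (p, 0 :: real, q)"
  define m where "m W n x = (\<Sum>i<n. W i x) / real n" for W :: "nat \<Rightarrow> 'a \<Rightarrow> real" and n x
  have [measurable]: "m W n \<in> borel_measurable M" if [measurable]: "\<And>i. W i \<in> borel_measurable M" for W n
    unfolding m_def by measurable
  define V where "V n x = v + (m W1 n x, m Y n x, m W2 n x)" for n x
  have Vm [measurable]: "V n \<in> borel_measurable M" for n
  proof -
    have "(\<lambda>x. v + (m W1 n x, m Y n x, m W2 n x)) \<in> borel_measurable M"
      by (intro borel_measurable_add borel_measurable_Pair) measurable
    thus ?thesis by (simp add: V_def[abs_def])
  qed
  have V_norm: "(norm (V n x - v))\<^sup>2 = (m W1 n x)\<^sup>2 + ((m Y n x)\<^sup>2 + (m W2 n x)\<^sup>2)" for n x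
    by (simp add: V_def norm_Pair)
  note m1 = sample_mean_sq[OF W1_indep W1mean W1sq, folded m_def]
  note m2 = sample_mean_sq[OF Y_indep Y1 Yint Y2, folded m_def]
  note m3 = sample_mean_sq[OF W2_indep W2mean W2sq, folded m_def]
  define C where "C = p * (1 - p) + (q + (\<kappa>4 - q\<^sup>2))"
  have V_int: "integrable M (\<lambda>x. (norm (V n x - v))\<^sup>2)" for n
    unfolding V_norm using m1(1) m2(1) m3(1) by simp
  have V_bound: "expectation (\<lambda>x. (norm (V n x - v))\<^sup>2) \<le> C / real n" if "n > 0" for n
    unfolding V_norm C_def using m1(1)[of n] m2(1)[of n] m3(1)[of n] m1(2)[OF that] m2(2)[OF that] m3(2)[OF that]
    by (simp add: add_divide_distrib)
  define F where "F = rate_of_moments \<alpha> \<theta>"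
  define F' where "F' = (\<lambda>h :: real \<times> real \<times> real. \<theta> * fst h - p * \<alpha> * \<theta> * fst (snd h)
      - p * (3 * \<alpha>\<^sup>2 * \<theta> * ln \<theta> / (2 * pi\<^sup>2)) * snd (snd h))"
  have Fv: "F v = p * \<theta>" and F': "(F has_derivative F') (at v)"
    unfolding F_def F'_def v_def q_def by (rule rate_of_moments_derivative[OF \<alpha>(1) \<theta>])+
  have [measurable]: "F \<in> borel_measurable borel" unfolding F_def by measurable
  have rem: "(\<lambda>n. prob {x \<in> space M. \<bar>sqrt (real n) * (F (V n x) - F v - F' (V n x - v))\<bar> \<ge> \<epsilon>}) \<longlonglongrightarrow> 0"
    if "\<epsilon> > 0" for \<epsilon>
    by (rule delta_method_remainder[OF Vm _ F' V_int V_bound that]) measurable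

  have sumB: "real (event_count K e n x) = (\<Sum>i<n. B i x)" for n x
  proof -
    have "{j. j < n \<and> K j x = e} = {j \<in> {..<n}. K j x = e}" by auto
    thus ?thesis unfolding event_count_def B_def by (simp add: sum.If_cases Int_def conj_commute)
  qed
  have lm: "log_mean S n x = m Y n x - ln \<theta> / \<alpha> - euler_mascheroni" if "n > 0" for n x
  proof -
    have "m Y n x = log_mean S n x + ln \<theta> / \<alpha> + euler_mascheroni"
      unfolding m_def log_mean_def Y_def y_def using that
      by (simp add: sum.distrib add_divide_distrib)
    thus ?thesis by simp
  qed
  have lv: "log_variance S n x = q + m W2 n x - (m Y n x)\<^sup>2" if "n > 0" for n x
  proof -
    have dev: "ln (S j x) - log_mean S n x = Y j x - m Y n x" for j
      unfolding lm[OF that] Y_def y_def by simp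
    have "log_variance S n x = (\<Sum>j<n. (Y j x)\<^sup>2 - 2 * m Y n x * Y j x + (m Y n x)\<^sup>2) / real n"
      unfolding log_variance_def dev by (simp add: power2_diff algebra_simps)
    also have "\<dots> = (\<Sum>j<n. (Y j x)\<^sup>2) / real n - 2 * m Y n x * ((\<Sum>j<n. Y j x) / real n) + (m Y n x)\<^sup>2"
      using that by (simp add: sum.distrib sum_subtractf sum_distrib_left[symmetric] add_divide_distrib diff_divide_distrib)
    also have "(\<Sum>j<n. Y j x) / real n = m Y n x" by (simp add: m_def)
    also have "(\<Sum>j<n. (Y j x)\<^sup>2) / real n = q + m W2 n x"
      using that by (simp add: m_def W2_def sum_subtractf diff_divide_distrib)
    finally show ?thesis by (simp add: power2_eq_square)
  qed
  have rate: "rate_hat S K e n x = F (V n x)" if n: "n > 0" for n x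
  proof -
    have "p_hat K e n x = p + m W1 n x"
      using n by (simp add: p_hat_def sumB m_def W1_def sum_subtractf diff_divide_distrib)
    thus ?thesis
      unfolding rate_hat_def theta_hat_def alpha_hat_def lm[OF n] lv[OF n] F_def rate_of_moments_def V_def v_def
      by simp
  qed
  have F'V: "F' (V n x - v) = (\<Sum>i<n. Z i x) / real n" for n x
    unfolding F'_def c_def[symmetric] V_def m_def Z_def T_def
    by (simp add: sum_subtractf sum.distrib sum_distrib_left[symmetric] diff_divide_distrib add_divide_distrib algebra_simps)
  \<comment> \<open>For \<open>n = 0\<close> the estimator involves divisions by zero, so the identity for \<open>R\<close> holds for \<open>n > 0\<close> only.\<close>
  define X where "X n x = sqrt (real n) * ((\<Sum>i<n. Z i x) / real n)" for n x
  define R where "R n x = sqrt (real n) * (rate_hat S K e n x - p * \<theta>) - X n x" for n x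
  have [measurable]: "X n \<in> borel_measurable M" for n unfolding X_def by measurable
  have [measurable]: "rate_hat S K e n \<in> borel_measurable M" for n
    unfolding rate_hat_def theta_hat_def alpha_hat_def log_variance_def log_mean_def p_hat_def sumB by measurable
  have [measurable]: "R n \<in> borel_measurable M" for n unfolding R_def by measurable
  have R: "R n x = sqrt (real n) * (F (V n x) - F v - F' (V n x - v))" if "n > 0" for n x
    unfolding R_def X_def F'V Fv rate[OF that] by (simp add: algebra_simps)
  have "weak_conv_m (\<lambda>n. distr M borel (\<lambda>x. X n x + R n x)) (normal_law 0 \<sigma>2)"
  proof (rule weak_conv_m_add_vanishing)
    show "real_distribution (normal_law 0 \<sigma>2)" by (rule real_distribution_normal_law[OF \<sigma>2])
    show "weak_conv_m (\<lambda>n. distr M borel (X n)) (normal_law 0 \<sigma>2)" using clt by (simp add: X_def[abs_def])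
    fix \<epsilon> :: real assume \<epsilon>: "\<epsilon> > 0"
    have "eventually (\<lambda>n. prob {x \<in> space M. \<bar>sqrt (real n) * (F (V n x) - F v - F' (V n x - v))\<bar> \<ge> \<epsilon>} =
        prob {x \<in> space M. \<bar>R n x\<bar> \<ge> \<epsilon>}) sequentially"
      using eventually_gt_at_top[of 0] by eventually_elim (simp only: R)
    thus "(\<lambda>n. prob {x \<in> space M. \<bar>R n x\<bar> \<ge> \<epsilon>}) \<longlonglongrightarrow> 0"
      using rem[OF \<epsilon>] by (rule Lim_transform_eventually[rotated])
  qed measurable
  thus ?thesis by (simp add: R_def \<sigma>2_def)
qed

theorem theorem3p1:
  fixes M :: "'a measure"
    and S :: "nat \<Rightarrow> 'a \<Rightarrow> real"
    and K :: "nat \<Rightarrow> 'a \<Rightarrow> queue_event"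
    and lam mu xi \<alpha> \<theta> p1 p2 p3 :: real
  assumes rates: "lam > 0" "mu > 0" "xi > 0"
    and alpha: "0 < \<alpha>" "\<alpha> \<le> 1"
    and theta: "\<theta> = lam + mu + xi"
    and probs: "p1 = lam / \<theta>" "p2 = mu / \<theta>" "p3 = xi / \<theta>"
    and M: "prob_space M"
    and S_indep: "prob_space.indep_vars M (\<lambda>_. borel) S UNIV"
    and S_law: "\<And>j. distributed M lborel (S j) (\<lambda>t. ennreal (ml_waiting_density \<alpha> \<theta> t))"
    and K_indep: "prob_space.indep_vars M (\<lambda>_. count_space UNIV) K UNIV"
    and K_law: "\<And>j. measure M {\<omega> \<in> space M. K j \<omega> = Arrival} = p1"
      "\<And>j. measure M {\<omega> \<in> space M. K j \<omega> = Service} = p2"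
      "\<And>j. measure M {\<omega> \<in> space M. K j \<omega> = Catastrophe} = p3"
    and S_K_indep: "indep_rv_pair M
      (Pi\<^sub>M UNIV (\<lambda>_. borel)) (\<lambda>\<omega> j. S j \<omega>)
      (Pi\<^sub>M UNIV (\<lambda>_. count_space UNIV)) (\<lambda>\<omega> j. K j \<omega>)"
  shows
    "weak_conv_m (\<lambda>n. distr M borel (\<lambda>\<omega>. sqrt (real n) * (rate_hat S K Arrival n \<omega> - lam)))
       (normal_law 0 (\<theta>\<^sup>2 * p1 * (1 - p1) + p1\<^sup>2 * sigma_theta_sq \<alpha> \<theta>)) \<and>
     weak_conv_m (\<lambda>n. distr M borel (\<lambda>\<omega>. sqrt (real n) * (rate_hat S K Service n \<omega> - mu)))
       (normal_law 0 (\<theta>\<^sup>2 * p2 * (1 - p2) + p2\<^sup>2 * sigma_theta_sq \<alpha> \<theta>)) \<and>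
     weak_conv_m (\<lambda>n. distr M borel (\<lambda>\<omega>. sqrt (real n) * (rate_hat S K Catastrophe n \<omega> - xi)))
       (normal_law 0 (\<theta>\<^sup>2 * p3 * (1 - p3) + p3\<^sup>2 * sigma_theta_sq \<alpha> \<theta>))"
proof -
  interpret prob_space M by (rule M)
  have \<theta>: "\<theta> > 0" using rates theta by simp
  have p: "0 < p1" "p1 < 1" "0 < p2" "p2 < 1" "0 < p3" "p3 < 1"
    using rates \<theta> unfolding probs by (auto simp: theta)
  have eqs: "lam = p1 * \<theta>" "mu = p2 * \<theta>" "xi = p3 * \<theta>" using \<theta> by (simp_all add: probs)
  show ?thesis
    unfolding eqs
    by (intro conjI rate_hat_weak_conv[OF alpha \<theta> _ _ S_indep S_law K_indep _ S_K_indep] p K_law)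
qed

end
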